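(* Let $F$ be an order continuous Banach lattice with a weak unit, and let $\Omega$ be a probability space. Then every norm bounded submartingale $(z_n)$ in $L_1(\Omega;F)$ with respect to a classical filtration is almost surely uo-Cauchy in $F$, i.e. there is a set of measure $0$ outside of which $(z_n(\omega))_n$ is uo-Cauchy in $F$.
   Context: $L_1(\Omega;F)$ is the Banach lattice of (classes of) Bochner integrable $F$-valued functions on the probability space $(\Omega,\mathscr{F},P)$, with pointwise a.e. order. A classical filtration is a sequence $(E_n)$ of (vector-valued) conditional expectations $E_n=E(\cdot\,|\,\mathscr{F}_n)$ on $L_1(\Omega;F)$ for an increasing sequence $(\mathscr{F}_n)$ of sub-$\sigma$-fields of $\mathscr{F}$. A sequence $(z_n)$ is a submartingale relative to $(E_n)$ if $z_n\in\mathrm{Range}(E_n)$ and $E_nz_m\ge z_n$ for all $m\ge n$. A Banach lattice is order continuous if every order null net is norm null. A vector $x_0>0$ in $F$ is a weak unit if $x\wedge nx_0\uparrow x$ for all $x\ge 0$. A net $(x_\alpha)$ in a vector lattice order converges to $x$ ($x_\alpha\xrightarrow{o}x$) if there is a net $(y_\beta)$ (possibly over a different index set) with $y_\beta\downarrow 0$ such that for every $\beta$ there is $\alpha_0$ with $|x_\alpha-x|\le y_\beta$ for all $\alpha\ge\alpha_0$; it uo-converges to $x$ if $|x_\alpha-x|\wedge y\xrightarrow{o}0$ for all $y\ge 0$. A sequence $(x_n)$ is uo-Cauchy if the double-indexed net $(x_n-x_m)_{(n,m)}$ uo-converges to $0$. *)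

theory Defs
  imports "HOL-Probability.Probability" "HOL-Library.Lattice_Algebras" "HOL-Library.Lub_Glb"
begin

section \<open>Banach lattices\<close>

class banach_lattice = ordered_real_vector + lattice_ab_group_add_abs + banach +
  assumes norm_le_norm_if_abs_le: "\<bar>x\<bar> \<le> \<bar>y\<bar> \<Longrightarrow> norm x \<le> norm y"

section \<open>Nets, order convergence and unbounded order convergence\<close>

text \<open>A net is a function on a nonempty set \<open>I\<close> that is directed upwards by a preorder \<open>r\<close>.\<close>

definition directed_set :: "'i set \<Rightarrow> ('i \<Rightarrow> 'i \<Rightarrow> bool) \<Rightarrow> bool" where
  "directed_set I r \<longleftrightarrow>
     I \<noteq> {} \<and> reflp_on I r \<and> transp_on I r \<and> (\<forall>a\<in>I. \<forall>b\<in>I. \<exists>c\<in>I. r a c \<and> r b c)"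

definition net_decreases_to ::
    "'j set \<Rightarrow> ('j \<Rightarrow> 'j \<Rightarrow> bool) \<Rightarrow> ('j \<Rightarrow> 'a::order) \<Rightarrow> 'a \<Rightarrow> bool" where
  "net_decreases_to J r y l \<longleftrightarrow>
     directed_set J r \<and> monotone_on J r (\<ge>) y \<and> isGlb UNIV (y ` J) l"

text \<open>
  The index set \<open>J\<close> of the dominating net \<open>y\<close> is independent of \<open>I\<close>. HOL cannot quantify over
  types in a formula, so \<open>J\<close> is taken in the type of the values. Nothing is lost: a decreasing net
  can be indexed by its range, ordered by \<open>\<ge>\<close>; see \<open>order_convergesI\<close> below.
\<close>

definition order_converges ::
    "'i set \<Rightarrow> ('i \<Rightarrow> 'i \<Rightarrow> bool) \<Rightarrow> ('i \<Rightarrow> 'a::lattice_ab_group_add_abs) \<Rightarrow> 'a \<Rightarrow> bool" where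
  "order_converges I r x l \<longleftrightarrow>
     (\<exists>(J :: 'a set) s y. net_decreases_to J s y 0 \<and>
        (\<forall>b\<in>J. \<exists>a0\<in>I. \<forall>a\<in>I. r a0 a \<longrightarrow> \<bar>x a - l\<bar> \<le> y b))"

definition uo_converges ::
    "'i set \<Rightarrow> ('i \<Rightarrow> 'i \<Rightarrow> bool) \<Rightarrow> ('i \<Rightarrow> 'a::lattice_ab_group_add_abs) \<Rightarrow> 'a \<Rightarrow> bool" where
  "uo_converges I r x l \<longleftrightarrow> (\<forall>y\<ge>0. order_converges I r (\<lambda>a. inf \<bar>x a - l\<bar> y) 0)"

definition uo_Cauchy :: "(nat \<Rightarrow> 'a::lattice_ab_group_add_abs) \<Rightarrow> bool" where
  "uo_Cauchy x \<longleftrightarrow>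
     uo_converges (UNIV :: (nat \<times> nat) set)
       (\<lambda>p q. fst p \<le> fst q \<and> snd p \<le> snd q) (\<lambda>(n, m). x n - x m) 0"

definition norm_null_net ::
    "'i set \<Rightarrow> ('i \<Rightarrow> 'i \<Rightarrow> bool) \<Rightarrow> ('i \<Rightarrow> 'a::real_normed_vector) \<Rightarrow> bool" where
  "norm_null_net I r x \<longleftrightarrow> (\<forall>e>0. \<exists>a0\<in>I. \<forall>a\<in>I. r a0 a \<longrightarrow> norm (x a) < e)"

text \<open>
  Again the index sets are taken in the type of the values; \<open>order_continuousD\<close> below shows that
  the implication then holds for nets over index sets of any type.
\<close>

definition order_continuous :: "'a::banach_lattice itself \<Rightarrow> bool" where
  "order_continuous _ \<longleftrightarrow>
     (\<forall>(I :: 'a set) r (x :: 'a \<Rightarrow> 'a).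
        directed_set I r \<longrightarrow> order_converges I r x 0 \<longrightarrow> norm_null_net I r x)"

definition weak_unit :: "'a::banach_lattice \<Rightarrow> bool" where
  "weak_unit x0 \<longleftrightarrow>
     x0 > 0 \<and>
     (\<forall>x\<ge>0. incseq (\<lambda>n::nat. inf x (real n *\<^sub>R x0)) \<and>
            isLub UNIV (range (\<lambda>n::nat. inf x (real n *\<^sub>R x0))) x)"

lemma net_decreases_to_range:
  assumes "net_decreases_to J s y l"
  shows "net_decreases_to (y ` J) (\<ge>) (\<lambda>v. v) l"
proof -
  have dir: "J \<noteq> {}" "\<And>a b. a \<in> J \<Longrightarrow> b \<in> J \<Longrightarrow> \<exists>c\<in>J. s a c \<and> s b c"
    and mono: "\<And>a b. a \<in> J \<Longrightarrow> b \<in> J \<Longrightarrow> s a b \<Longrightarrow> y b \<le> y a"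
    and glb: "isGlb UNIV (y ` J) l"
    using assms unfolding net_decreases_to_def directed_set_def monotone_on_def by simp_all
  have "\<exists>w\<in>y ` J. w \<le> u \<and> w \<le> v" if "u \<in> y ` J" "v \<in> y ` J" for u v
  proof -
    from that obtain a b where ab: "a \<in> J" "u = y a" "b \<in> J" "v = y b" by blast
    then obtain c where "c \<in> J" "s a c" "s b c" using dir(2) by blast
    then show ?thesis using mono ab by blast
  qed
  moreover have "reflp_on (y ` J) (\<ge>)" "transp_on (y ` J) (\<ge>)"
    by (simp_all add: reflp_on_def transp_on_def)
  ultimately have "directed_set (y ` J) (\<ge>)"
    unfolding directed_set_def using dir(1) by blast
  then show ?thesis
    using glb unfolding net_decreases_to_def monotone_on_def by simp
qed

lemma order_convergesI:
  fixes x :: "'i \<Rightarrow> 'a::lattice_ab_group_add_abs" and J :: "'j set"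
  assumes "net_decreases_to J s y 0"
    and "\<And>b. b \<in> J \<Longrightarrow> \<exists>a0\<in>I. \<forall>a\<in>I. r a0 a \<longrightarrow> \<bar>x a - l\<bar> \<le> y b"
  shows "order_converges I r x l"
proof -
  have "\<forall>b\<in>y ` J. \<exists>a0\<in>I. \<forall>a\<in>I. r a0 a \<longrightarrow> \<bar>x a - l\<bar> \<le> b"
    using assms(2) by blast
  with net_decreases_to_range[OF assms(1)] show ?thesis
    unfolding order_converges_def by blast
qed

lemma order_continuousD:
  fixes x :: "'i \<Rightarrow> 'a::banach_lattice"
  assumes oc: "order_continuous TYPE('a)" and x: "order_converges I r x 0"
  shows "norm_null_net I r x"
proof -
  from x obtain J :: "'a set" and s y where y: "net_decreases_to J s y 0"
    and dom: "\<And>b. b \<in> J \<Longrightarrow> \<exists>a0\<in>I. \<forall>a\<in>I. r a0 a \<longrightarrow> \<bar>x a\<bar> \<le> y b"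
    unfolding order_converges_def by auto
  have dir: "directed_set J s" and mono: "\<And>a b. a \<in> J \<Longrightarrow> b \<in> J \<Longrightarrow> s a b \<Longrightarrow> y b \<le> y a"
    and glb: "isGlb UNIV (y ` J) 0"
    using y by (auto simp: net_decreases_to_def monotone_on_def)
  have pos: "0 \<le> y b" if "b \<in> J" for b
    using glb that by (auto simp: isGlb_def isLb_def greatestP_def setge_def)
  have "order_converges J s y 0"
    by (rule order_convergesI[OF y]) (use mono pos in \<open>auto simp: abs_of_nonneg\<close>)
  with oc dir have "norm_null_net J s y"
    unfolding order_continuous_def by blast
  moreover have "s b b" if "b \<in> J" for b
    using dir that by (auto simp: directed_set_def reflp_on_def)
  ultimately have small: "\<exists>b\<in>J. norm (y b) < e" if "e > 0" for e
    using that unfolding norm_null_net_def by blast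
  show ?thesis
    unfolding norm_null_net_def
  proof (intro allI impI)
    fix e :: real assume "e > 0"
    then obtain b where b: "b \<in> J" "norm (y b) < e" using small by blast
    obtain a0 where a0: "a0 \<in> I" "\<And>a. a \<in> I \<Longrightarrow> r a0 a \<Longrightarrow> \<bar>x a\<bar> \<le> y b"
      using dom[OF b(1)] by blast
    have "norm (x a) < e" if "a \<in> I" "r a0 a" for a
    proof -
      have "\<bar>x a\<bar> \<le> \<bar>y b\<bar>" using a0(2)[OF that] pos[OF b(1)] by (simp add: abs_of_nonneg)
      then show ?thesis using norm_le_norm_if_abs_le b(2) by fastforce
    qed
    with a0(1) show "\<exists>a0\<in>I. \<forall>a\<in>I. r a0 a \<longrightarrow> norm (x a) < e" by blast
  qed
qed

section \<open>The space of Bochner integrable functions\<close>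

text \<open>
  The Bochner integral of HOL-Analysis requires a second countable, i.e. separable, range space.
  Below it is restated verbatim for arbitrary normed spaces, with Borel measurability replaced by
  strong measurability; \<open>has_strong_integral_iff\<close> states that nothing changes in the separable case.
  Functions stand for their almost everywhere classes; every class has a representative that is the
  pointwise limit of simple functions everywhere.
\<close>

definition strongly_measurable :: "'w measure \<Rightarrow> ('w \<Rightarrow> 'b::real_normed_vector) \<Rightarrow> bool" where
  "strongly_measurable M f \<longleftrightarrow>
     (\<exists>s. (\<forall>i::nat. simple_function M (s i)) \<and> (\<forall>w\<in>space M. (\<lambda>i. s i w) \<longlonglongrightarrow> f w))"

definition has_strong_integral ::
    "'w measure \<Rightarrow> ('w \<Rightarrow> 'b::real_normed_vector) \<Rightarrow> 'b \<Rightarrow> bool" where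
  "has_strong_integral M f x \<longleftrightarrow>
     strongly_measurable M f \<and>
     (\<exists>s. (\<forall>i::nat. Bochner_Integration.simple_bochner_integrable M (s i)) \<and>
          (\<lambda>i. \<integral>\<^sup>+w. norm (f w - s i w) \<partial>M) \<longlonglongrightarrow> 0 \<and>
          (\<lambda>i. Bochner_Integration.simple_bochner_integral M (s i)) \<longlonglongrightarrow> x)"

definition L1 :: "'w measure \<Rightarrow> ('w \<Rightarrow> 'b::real_normed_vector) set" where
  "L1 M = {f. \<exists>x. has_strong_integral M f x}"

definition strong_integral :: "'w measure \<Rightarrow> ('w \<Rightarrow> 'b::real_normed_vector) \<Rightarrow> 'b" where
  "strong_integral M f = (THE x. has_strong_integral M f x)"

lemma strongly_measurable_iff:
  fixes f :: "'w \<Rightarrow> 'b::{real_normed_vector, second_countable_topology}"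
  shows "strongly_measurable M f \<longleftrightarrow> f \<in> borel_measurable M"
proof
  assume "strongly_measurable M f"
  then obtain s where s: "\<forall>i::nat. simple_function M (s i)"
    and lim: "\<forall>w\<in>space M. (\<lambda>i. s i w) \<longlonglongrightarrow> f w"
    unfolding strongly_measurable_def by (elim exE conjE)
  show "f \<in> borel_measurable M"
  proof (rule borel_measurable_LIMSEQ_metric)
    show "s i \<in> borel_measurable M" for i
      using s by (blast intro: borel_measurable_simple_function)
    show "(\<lambda>i. s i w) \<longlonglongrightarrow> f w" if "w \<in> space M" for w
      using lim that by (rule bspec)
  qed
next
  assume "f \<in> borel_measurable M"
  from borel_measurable_implies_sequence_metric[OF this, of 0]
  obtain s where "\<forall>i. simple_function M (s i)" "\<forall>w\<in>space M. (\<lambda>i. s i w) \<longlonglongrightarrow> f w"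
    by (elim exE conjE)
  then show "strongly_measurable M f"
    unfolding strongly_measurable_def by (intro exI conjI)
qed

lemma has_strong_integral_iff:
  fixes f :: "'w \<Rightarrow> 'b::{real_normed_vector, second_countable_topology}"
  shows "has_strong_integral M f x \<longleftrightarrow> has_bochner_integral M f x"
proof
  assume "has_strong_integral M f x"
  then show "has_bochner_integral M f x"
    unfolding has_strong_integral_def strongly_measurable_iff
    by (elim conjE exE) (rule has_bochner_integral.intros, (erule spec | assumption)+)
next
  assume "has_bochner_integral M f x"
  then show "has_strong_integral M f x"
    unfolding has_strong_integral_def strongly_measurable_iff
    by (rule has_bochner_integral.cases) (intro conjI exI allI)
qed

section \<open>Classical filtrations and submartingales\<close>

text \<open>
  \<open>is_cond_exp M G f g\<close>: \<open>g\<close> is a version of the conditional expectation of \<open>f\<close> given the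
  sub-\<open>\<sigma>\<close>-field \<open>sets G\<close>. Only \<open>space G\<close> and \<open>sets G\<close> matter; all integrals are over \<open>M\<close>.
\<close>

definition is_cond_exp ::
    "'w measure \<Rightarrow> 'w measure \<Rightarrow> ('w \<Rightarrow> 'b::real_normed_vector) \<Rightarrow> ('w \<Rightarrow> 'b) \<Rightarrow> bool" where
  "is_cond_exp M G f g \<longleftrightarrow>
     strongly_measurable G g \<and> g \<in> L1 M \<and>
     (\<forall>A\<in>sets G. strong_integral M (\<lambda>w. indicator A w *\<^sub>R g w) =
                 strong_integral M (\<lambda>w. indicator A w *\<^sub>R f w))"

text \<open>
  The operators \<open>E n\<close> act on representatives; which version of the conditional expectation
  \<open>E n f\<close> is, is left open.
\<close>

definition classical_filtration ::
    "'w measure \<Rightarrow> (nat \<Rightarrow> ('w \<Rightarrow> 'b::real_normed_vector) \<Rightarrow> ('w \<Rightarrow> 'b)) \<Rightarrow> bool" where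
  "classical_filtration M E \<longleftrightarrow>
     (\<exists>F :: nat \<Rightarrow> 'w measure.
        filtration (space M) F \<and> (\<forall>n. subalgebra M (F n)) \<and>
        (\<forall>n. \<forall>f\<in>L1 M. is_cond_exp M (F n) f (E n f)))"

definition submartingale ::
    "'w measure \<Rightarrow> (nat \<Rightarrow> ('w \<Rightarrow> 'b::banach_lattice) \<Rightarrow> ('w \<Rightarrow> 'b)) \<Rightarrow> (nat \<Rightarrow> 'w \<Rightarrow> 'b) \<Rightarrow> bool"
  where
  "submartingale M E z \<longleftrightarrow>
     (\<forall>n. z n \<in> L1 M \<and> (\<exists>f\<in>L1 M. AE w in M. z n w = E n f w)) \<and>
     (\<forall>n m. n \<le> m \<longrightarrow> (AE w in M. z n w \<le> E n (z m) w))"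

definition L1_norm_bounded ::
    "'w measure \<Rightarrow> (nat \<Rightarrow> 'w \<Rightarrow> 'b::real_normed_vector) \<Rightarrow> bool" where
  "L1_norm_bounded M z \<longleftrightarrow> (\<exists>C. \<forall>n. (LINT w|M. norm (z n w)) \<le> C)"

end

theory Submission
  imports Defs
begin

text \<open>
  All estimates are lattice-linear and hold with values in \<open>F\<close>, the weak unit \<open>x0\<close> playing the role
  of the constant \<open>1\<close>; no representation of \<open>F\<close> as a function space is needed. For real \<open>a\<close> the
  integrals of the positive parts \<open>(z n - a x0)\<^sup>+\<close> increase and are norm bounded, so by order
  continuity their increments, truncated at \<open>x0\<close>, become small in norm. Taking \<open>a\<close> from a fine finite
  grid, this controls \<open>E n ((z m - z n)\<^sup>+)\<close>. Doob's maximal inequality turns it into a bound on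
  the integral of \<open>sup {\<bar>z i - z n\<bar> \<and> x0 | n \<le> i \<le> m}\<close> that is small in norm, uniformly in \<open>m\<close>.
  Hence the decreasing limit of the tail oscillations has integral \<open>0\<close> and vanishes almost surely.
\<close>

section \<open>Inequalities in vector lattices\<close>

text \<open>The increments themselves need not become small: a norm bounded increasing sequence in
  \<open>F\<close> may diverge, and a martingale that is merely bounded in \<open>L1\<close> need
  not be uniformly integrable. Smallness is available only after truncation at \<open>x0\<close>, so
  every estimate has to carry the truncation along, and it acts on
  \<open>E n (increment n m)\<close>, not on the increment under \<open>E n\<close>. The levels
  \<open>a\<close> are forced as well: for a martingale the integrals of \<open>z n\<close> do not
  move and reveal no oscillation. The convex functions \<open>pprt (x - a *\<^sub>R x0)\<close> do,
  but each only near its own level, the error being \<open>\<bar>z n - a *\<^sub>R x0\<bar>\<close>.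
  The index from which the increments are small depends on \<open>a\<close>, hence a finite grid.
  Where real-valued functions would allow a case distinction at each point, \<open>F\<close> offers
  only disjointness, \<open>inf (pprt a) (pprt (- a)) = 0\<close>; indicators and choices of a
  nearest grid point are rewritten in terms of it. The weak unit returns at the end: smallness of
  differences truncated at \<open>x0\<close> carries over to every \<open>y \<ge> 0\<close>.\<close>

lemma add_inf_le_of_nonneg:
  fixes a :: "'a::lattice_ab_group_add"
  assumes "0 \<le> a"
  shows "inf (a + b) c \<le> a + inf b c"
  using assms by (simp add: add_inf_distrib_left le_infI2 add_increasing)

lemma inf_add_le:
  fixes a :: "'a::lattice_ab_group_add"
  assumes "0 \<le> a" "0 \<le> b" "0 \<le> c"
  shows "inf (b + c) a \<le> inf b a + inf c a"
  using assms
  by (simp add: add_inf_distrib_left add_inf_distrib_right le_infI1 le_infI2 add_increasing add_increasing2)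

lemma inf_sum_le:
  fixes a :: "'a::lattice_ab_group_add"
  assumes "finite I" "0 \<le> a" "\<And>i. i \<in> I \<Longrightarrow> 0 \<le> f i"
  shows "inf (sum f I) a \<le> (\<Sum>i\<in>I. inf (f i) a)"
  using assms
proof (induction I)
  case (insert j I)
  have "inf (sum f (insert j I)) a \<le> inf (f j) a + inf (sum f I) a"
    using insert by (simp add: inf_add_le sum_nonneg)
  also have "\<dots> \<le> inf (f j) a + (\<Sum>i\<in>I. inf (f i) a)"
    using insert by (intro add_left_mono) simp
  finally show ?case using insert by simp
qed simp

lemma pprt_le_iff: "pprt a \<le> b \<longleftrightarrow> a \<le> b \<and> 0 \<le> (b::'a::lattice_ab_group_add)"
  by (simp add: pprt_def)

lemma le_pprt: "a \<le> pprt (a::'a::lattice_ab_group_add)"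
  by (simp add: pprt_def)

lemma pprt_add_le: "pprt (a + b) \<le> pprt a + pprt (b::'a::lattice_ab_group_add)"
  by (simp add: pprt_le_iff add_mono le_pprt)

text \<open>Translating by \<open>pprt (- a)\<close> turns the infimum into
  \<open>inf a 0 + pprt (- a)\<close>, the sum of the negative part and its opposite. This
  disjointness replaces the case distinction between \<open>a \<ge> 0\<close> and
  \<open>a \<le> 0\<close> in all later estimates.\<close>

lemma inf_pprt_pprt_uminus: "inf (pprt a) (pprt (- a)) = (0::'a::lattice_ab_group_add)"
proof -
  have "inf (pprt a) (pprt (- a)) = inf (a + pprt (- a)) (0 + pprt (- a))"
    using prts[of a] by (metis add_diff_cancel_right' diff_conv_add_uminus pprt_neg add.left_neutral)
  also have "\<dots> = inf a 0 + pprt (- a)"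
    by (rule add_inf_distrib_right[symmetric])
  finally show ?thesis by (simp add: pprt_neg flip: nprt_def)
qed

lemma abs_eq_pprt: "\<bar>a\<bar> = pprt a + pprt (- (a::'a::lattice_ab_group_add_abs))"
  by (simp add: abs_prts pprt_neg)

lemma sup_eq_pprt: "sup a b = b + pprt (a - (b::'a::lattice_ab_group_add))"
  by (simp add: pprt_def add_sup_distrib_left)

lemma inf_eq_pprt: "inf a b = b - pprt (b - (a::'a::lattice_ab_group_add))"
  by (simp add: pprt_def add_inf_distrib_left)

lemma abs_pprt_diff_le:
  "\<bar>pprt a - pprt b\<bar> \<le> \<bar>a - (b::'a::lattice_ab_group_add_abs)\<bar>"
proof (rule abs_leI)
  have "pprt a \<le> pprt b + \<bar>a - b\<bar>" for a b :: 'a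
  proof -
    have "a \<le> pprt b + \<bar>a - b\<bar>"
      using add_mono[OF le_pprt abs_ge_self, of b "a - b"] by simp
    then show ?thesis by (simp add: pprt_le_iff)
  qed
  from this[of a b] this[of b a]
  show "pprt a - pprt b \<le> \<bar>a - b\<bar>" "- (pprt a - pprt b) \<le> \<bar>a - b\<bar>"
    by (simp_all add: algebra_simps abs_minus_commute)
qed

lemma inf_abs_diff_triangle:
  fixes a b x :: "'a::lattice_ab_group_add_abs"
  assumes "0 \<le> x"
  shows "inf \<bar>a - b\<bar> x \<le> inf \<bar>a - c\<bar> x + inf \<bar>b - c\<bar> x"
proof -
  have "\<bar>a - b\<bar> \<le> \<bar>a - c\<bar> + \<bar>b - c\<bar>"
    using abs_triangle_ineq4[of "a - c" "b - c"] by simp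
  then have "inf \<bar>a - b\<bar> x \<le> inf (\<bar>a - c\<bar> + \<bar>b - c\<bar>) x"
    by (meson inf_mono order_refl)
  also have "\<dots> \<le> inf \<bar>a - c\<bar> x + inf \<bar>b - c\<bar> x"
    using assms by (intro inf_add_le) auto
  finally show ?thesis .
qed

lemma pprt_diff_triangle:
  "pprt (x - y) \<le> pprt (x - a) + pprt (a - (y::'a::lattice_ab_group_add))"
  using pprt_add_le[of "x - a" "a - y"] by simp

text \<open>One inequality is the minimality of \<open>pprt\<close> among the upper bounds of a
  vector and \<open>0\<close>; the other is the same inequality for the scalar
  \<open>1 / c\<close>.\<close>

lemma scaleR_pprt:
  fixes x :: "'a::banach_lattice"
  assumes "0 \<le> c"
  shows "c *\<^sub>R pprt x = pprt (c *\<^sub>R x)"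
proof (cases "c = 0")
  case False
  then have c: "0 < c" using assms by simp
  have *: "pprt (c *\<^sub>R x) \<le> c *\<^sub>R pprt x" if "0 < c" for c :: real and x :: 'a
    using that by (simp add: pprt_le_iff le_pprt scaleR_left_mono scaleR_nonneg_nonneg)
  have "c *\<^sub>R pprt x \<le> pprt (c *\<^sub>R x)"
    using *[of "1 / c" "c *\<^sub>R x"] c scaleR_left_mono[of "pprt x" "(1 / c) *\<^sub>R pprt (c *\<^sub>R x)" c] by simp
  with *[OF c, of x] show ?thesis by (rule antisym[rotated])
qed simp

lemma scaleR_inf:
  fixes x :: "'a::banach_lattice"
  assumes "0 \<le> c"
  shows "c *\<^sub>R inf x y = inf (c *\<^sub>R x) (c *\<^sub>R y)"
  using assms by (simp add: inf_eq_pprt scaleR_diff_right scaleR_pprt)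

lemma inf_scaleR_le:
  fixes x :: "'a::banach_lattice"
  assumes "1 \<le> c" "0 \<le> y"
  shows "inf (c *\<^sub>R x) y \<le> c *\<^sub>R inf x y"
proof -
  have "y \<le> c *\<^sub>R y" using scaleR_right_mono[of 1 c y] assms by simp
  then show ?thesis using assms by (simp add: scaleR_inf le_infI2)
qed

text \<open>For reals: where \<open>y > u\<close> the truncation at \<open>u\<close> suffices,
  elsewhere the left side vanishes. In a lattice, \<open>u\<close> is at most
  \<open>y + pprt (u - y)\<close>, and \<open>pprt (u - y)\<close> is disjoint from every multiple
  of \<open>pprt (y - u)\<close>, however large \<open>c\<close> is.\<close>

lemma pprt_diff_inf_le:
  fixes y u :: "'a::banach_lattice"
  assumes "0 \<le> y" "0 \<le> u" "0 \<le> c"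
  shows "inf (c *\<^sub>R pprt (y - u)) u \<le> y"
proof -
  let ?v = "pprt (y - u)" and ?w = "pprt (u - y)"
  have "u \<le> y + ?w" using le_pprt[of "u - y"] by (simp add: algebra_simps)
  have disj: "inf (c *\<^sub>R ?v) ?w \<le> 0"
  proof (cases "c \<le> 1")
    case True
    then have "c *\<^sub>R ?v \<le> ?v" using scaleR_right_mono[of c 1 ?v] by simp
    then have "inf (c *\<^sub>R ?v) ?w \<le> inf ?v ?w" by (meson inf_mono order_refl)
    then show ?thesis using inf_pprt_pprt_uminus[of "y - u"] by (metis minus_diff_eq)
  next
    case False
    then have "inf (c *\<^sub>R ?v) ?w \<le> c *\<^sub>R inf ?v ?w" by (intro inf_scaleR_le) auto
    then show ?thesis using inf_pprt_pprt_uminus[of "y - u"] by simp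
  qed
  have "inf (c *\<^sub>R ?v) u \<le> inf (y + ?w) (c *\<^sub>R ?v)"
    using \<open>u \<le> y + ?w\<close> by (simp add: le_infI2)
  also have "\<dots> \<le> y + inf ?w (c *\<^sub>R ?v)"
    by (rule add_inf_le_of_nonneg[OF assms(1)])
  also have "\<dots> \<le> y" using disj by (simp add: inf_commute)
  finally show ?thesis .
qed

text \<open>Markov's inequality in lattice form: the left side plays the role of \<open>u\<close>
  times the indicator of \<open>y > r *\<^sub>R u\<close>. It is the preceding lemma for
  \<open>(1 / r) *\<^sub>R y\<close> with \<open>c = r\<close>.\<close>

lemma pprt_diff_scaleR_inf_le:
  fixes y u :: "'a::banach_lattice"
  assumes "0 \<le> y" "0 \<le> u" "0 < r"
  shows "inf (pprt (y - r *\<^sub>R u)) u \<le> (1 / r) *\<^sub>R y"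
proof -
  have "pprt (y - r *\<^sub>R u) = r *\<^sub>R pprt ((1 / r) *\<^sub>R y - u)"
    using assms by (simp add: scaleR_pprt scaleR_diff_right)
  with pprt_diff_inf_le[of "(1 / r) *\<^sub>R y" u r] assms show ?thesis
    by (simp add: scaleR_nonneg_nonneg)
qed

text \<open>Since \<open>u \<le> q + pprt (u - q)\<close>, the left side is at most \<open>q\<close>
  plus the infimum of a multiple of \<open>pprt (q - u)\<close> and \<open>pprt (u - q)\<close>,
  which are disjoint.\<close>

lemma add_pprt_inf_le:
  fixes q u :: "'a::banach_lattice"
  assumes "0 \<le> q" "0 \<le> u" "0 \<le> c"
  shows "inf (inf (pprt (c *\<^sub>R (q - u))) u + q) u \<le> q"
proof -
  let ?a = "pprt (c *\<^sub>R (q - u))" and ?w = "pprt (u - q)"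
  have "u \<le> q + ?w" using le_pprt[of "u - q"] by (simp add: algebra_simps)
  have "inf (inf ?a u + q) u \<le> inf (q + ?a) (q + ?w)"
    using \<open>u \<le> q + ?w\<close> by (simp add: le_infI1 le_infI2 add.commute)
  also have "\<dots> = q + inf ?a ?w" by (rule add_inf_distrib_left[symmetric])
  also have "inf ?a ?w = 0"
  proof -
    \<comment> \<open>The common factor \<open>1 + c\<close> dominates both \<open>c\<close> and
      \<open>1\<close>, so scaling a disjoint pair by it covers both terms without a case
      distinction on \<open>c\<close>.\<close>
    have "inf ((1 + c) *\<^sub>R pprt (q - u)) ((1 + c) *\<^sub>R ?w) = 0"
      using assms inf_pprt_pprt_uminus[of "q - u"] by (simp add: scaleR_inf[symmetric])
    moreover have "?a \<le> (1 + c) *\<^sub>R pprt (q - u)" "?w \<le> (1 + c) *\<^sub>R ?w"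
      using assms scaleR_right_mono[of c "1 + c" "pprt (q - u)"] scaleR_right_mono[of 1 "1 + c" ?w]
      by (simp_all add: scaleR_pprt[symmetric])
    ultimately have "inf ?a ?w \<le> 0" by (metis inf_mono)
    then show ?thesis by (simp add: antisym)
  qed
  finally show ?thesis by simp
qed

lemma inf_diff_le:
  fixes a b u :: "'a::banach_lattice"
  assumes "0 \<le> a" "a \<le> b" "0 \<le> u" "0 < r"
  shows "inf (b - a) u \<le> (inf b (r *\<^sub>R u) - inf a (r *\<^sub>R u)) + (1 / r) *\<^sub>R b"
proof -
  let ?k = "r *\<^sub>R u"
  have split: "x = inf x ?k + pprt (x - ?k)" for x
    using inf_eq_pprt[of ?k x] by (simp add: inf_commute)
  have le: "inf a ?k \<le> inf b ?k" using assms by (meson inf_mono order_refl)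
  have "b - a \<le> (inf b ?k - inf a ?k) + pprt (b - ?k)"
    using split[of a] split[of b] zero_le_pprt[of "a - ?k"]
    by (metis add_diff_eq add.commute diff_left_mono diff_add_eq diff_diff_add le_add_same_cancel1)
  then have "inf (b - a) u \<le> inf ((inf b ?k - inf a ?k) + pprt (b - ?k)) u"
    by (meson inf_mono order_refl)
  also have "\<dots> \<le> (inf b ?k - inf a ?k) + inf (pprt (b - ?k)) u"
    using le by (intro add_inf_le_of_nonneg) (simp only: diff_ge_0_iff_ge)
  also have "\<dots> \<le> (inf b ?k - inf a ?k) + (1 / r) *\<^sub>R b"
    using assms by (intro add_left_mono pprt_diff_scaleR_inf_le) auto
  finally show ?thesis .
qed

text \<open>For a real \<open>x\<close> one would use the nearest grid point, or the overshoot
  beyond an end of the grid. A vector has no single nearest grid point, so the grid points are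
  adjoined one by one and disjointness does the selection.\<close>

lemma le_grid_bound:
  fixes x u :: "'a::banach_lattice"
  assumes "0 \<le> u" "0 \<le> h" "\<And>j. j \<le> k \<Longrightarrow> g \<le> d + \<bar>x - (a + real j * h) *\<^sub>R u\<bar>"
  shows "g \<le> d + h *\<^sub>R u + pprt (a *\<^sub>R u - x) + pprt (x - (a + real k * h) *\<^sub>R u)"
  using assms(3)
proof (induction k)
  case 0
  have "g \<le> d + (pprt (x - a *\<^sub>R u) + pprt (a *\<^sub>R u - x))"
    using 0[of 0] by (simp add: abs_eq_pprt)
  also have "\<dots> \<le> h *\<^sub>R u + (d + (pprt (x - a *\<^sub>R u) + pprt (a *\<^sub>R u - x)))"
    using assms by (simp add: scaleR_nonneg_nonneg)
  finally show ?case by (simp add: ac_simps)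
next
  case (Suc k)
  let ?h = "h *\<^sub>R u" and ?c = "(a + real k * h) *\<^sub>R u" and ?c' = "(a + real (Suc k) * h) *\<^sub>R u"
  let ?A = "pprt (a *\<^sub>R u - x)" and ?v = "pprt (x - ?c')" and ?w = "pprt (?c' - x)"
  have c': "?c' = ?c + ?h" by (simp add: algebra_simps)
  have h: "0 \<le> ?h" using assms by (simp add: scaleR_nonneg_nonneg)
  have "g \<le> d + ?h + ?A + pprt (x - ?c)"
    by (rule Suc.IH) (rule Suc.prems, simp)
  also have "\<dots> \<le> (d + ?h + ?A + ?v) + pprt (x - ?c)" by simp
  finally have 1: "g \<le> (d + ?h + ?A + ?v) + pprt (x - ?c)" .
  have "?c' - x \<le> ?h + pprt (?c - x)"
    unfolding c' using le_pprt[of "?c - x"] by (simp add: algebra_simps)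
  then have w: "?w \<le> ?h + pprt (?c - x)"
    using h by (simp add: pprt_le_iff)
  have "g \<le> d + (?v + ?w)" using Suc.prems[of "Suc k"] by (simp add: abs_eq_pprt)
  also have "\<dots> \<le> d + (?v + (?h + pprt (?c - x)))"
    using w by (intro add_left_mono)
  also have "\<dots> \<le> (d + ?h + ?A + ?v) + pprt (?c - x)"
    by (simp add: algebra_simps)
  \<comment> \<open>The two bounds for \<open>g\<close> differ only in the last term,
    \<open>pprt (x - ?c)\<close> against \<open>pprt (?c - x)\<close>. These are disjoint, so the
    infimum of the two bounds loses that term.\<close>
  finally have "g \<le> (d + ?h + ?A + ?v) + inf (pprt (x - ?c)) (pprt (?c - x))"
    using 1 by (simp add: add_inf_distrib_left)
  then show ?case using inf_pprt_pprt_uminus[of "x - ?c"] by simp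
qed

section \<open>Order continuous Banach lattices\<close>

lemma norm_mono_banach_lattice:
  fixes x :: "'a::banach_lattice"
  assumes "0 \<le> x" "x \<le> y"
  shows "norm x \<le> norm y"
  using assms by (intro norm_le_norm_if_abs_le) (simp add: abs_of_nonneg)

lemma norm_abs_banach_lattice [simp]:
  fixes x :: "'a::banach_lattice"
  shows "norm \<bar>x\<bar> = norm x"
  by (intro antisym norm_le_norm_if_abs_le) simp_all

lemma norm_pprt_diff_le:
  fixes x :: "'a::banach_lattice"
  shows "norm (pprt x - pprt y) \<le> norm (x - y)"
  by (intro norm_le_norm_if_abs_le abs_pprt_diff_le)

lemma norm_pprt_le:
  fixes x :: "'a::banach_lattice"
  shows "norm (pprt x) \<le> norm x"
  using norm_pprt_diff_le[of x 0] by simp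

lemma continuous_on_pprt: "continuous_on A (pprt :: 'a::banach_lattice \<Rightarrow> 'a)"
  by (rule continuous_on_iff[THEN iffD2])
     (metis dist_norm norm_pprt_diff_le order.strict_trans1)

lemma continuous_on_pprt' [continuous_intros]:
  fixes f :: "'b::topological_space \<Rightarrow> 'a::banach_lattice"
  shows "continuous_on A f \<Longrightarrow> continuous_on A (\<lambda>x. pprt (f x))"
  by (rule continuous_on_compose2[OF continuous_on_pprt]) auto

lemma continuous_on_inf [continuous_intros]:
  fixes f :: "'b::topological_space \<Rightarrow> 'a::banach_lattice"
  shows "continuous_on A f \<Longrightarrow> continuous_on A g \<Longrightarrow> continuous_on A (\<lambda>x. inf (f x) (g x))"
  unfolding inf_eq_pprt by (intro continuous_intros)

text \<open>The positive cone is the fixed point set of the continuous map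
  \<open>pprt\<close>.\<close>

lemma closed_nonneg: "closed {x :: 'a::banach_lattice. 0 \<le> x}"
proof -
  have "{x :: 'a. 0 \<le> x} = {x. pprt x = x}"
    by (auto simp: le_zero_iff_pprt_id)
  then show ?thesis
    by (simp add: closed_Collect_eq continuous_on_pprt)
qed

lemma LIMSEQ_nonneg:
  fixes l :: "'a::banach_lattice"
  assumes "X \<longlonglongrightarrow> l" "\<forall>\<^sub>F n in sequentially. 0 \<le> X n"
  shows "0 \<le> l"
  using Lim_in_closed_set[OF closed_nonneg _ _ assms(1)] assms(2) by simp

lemma LIMSEQ_le_lattice:
  fixes l :: "'a::banach_lattice"
  assumes "X \<longlonglongrightarrow> l" "Y \<longlonglongrightarrow> m" "\<forall>\<^sub>F n in sequentially. X n \<le> Y n"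
  shows "l \<le> m"
  using LIMSEQ_nonneg[OF tendsto_diff[OF assms(2,1)]] assms(3) by simp

text \<open>Dividing the hypothesis by \<open>k\<close> and letting \<open>k\<close> grow puts
  \<open>w\<close> below a null sequence; the positive cone is closed.\<close>

lemma order_Archimedean:
  fixes w b :: "'a::banach_lattice"
  assumes "\<And>k::nat. real k *\<^sub>R w \<le> b"
  shows "w \<le> 0"
proof (rule LIMSEQ_le_lattice)
  show "(\<lambda>k. inverse (real (Suc k)) *\<^sub>R b) \<longlonglongrightarrow> 0"
    using tendsto_scaleR[OF LIMSEQ_inverse_real_of_nat tendsto_const, of b] by simp
  show "\<forall>\<^sub>F k in sequentially. w \<le> inverse (real (Suc k)) *\<^sub>R b"
  proof (intro always_eventually allI)
    fix k
    show "w \<le> inverse (real (Suc k)) *\<^sub>R b"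
      using scaleR_left_mono[OF assms[of "Suc k"], of "inverse (real (Suc k))"] by simp
  qed
qed (rule tendsto_const)

text \<open>
  If \<open>w\<close> lies below every difference \<open>u - X n\<close> with \<open>u\<close> an upper bound, then \<open>u - w\<close> is again an
  upper bound; iterating and using the Archimedean property shows that these differences decrease
  to \<open>0\<close>, so order continuity makes the sequence Cauchy.
\<close>

lemma order_bounded_incseq_convergent:
  fixes X :: "nat \<Rightarrow> 'a::banach_lattice"
  assumes oc: "order_continuous TYPE('a)" and inc: "incseq X" and bound: "\<And>n. X n \<le> b"
  shows "convergent X"
proof -
  \<comment> \<open>No supremum of \<open>X\<close> is known to exist at this point. Its place is
    taken by the set of all upper bounds, which \<open>inf\<close> directs downwards.\<close>
  define I where "I = {u. \<forall>n. X n \<le> u} \<times> (UNIV :: nat set)"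
  define r where "r = (\<lambda>p q :: 'a \<times> nat. fst q \<le> fst p \<and> snd p \<le> snd q)"
  define y where "y = (\<lambda>p :: 'a \<times> nat. fst p - X (snd p))"
  have dir: "directed_set I r"
    unfolding directed_set_def
  proof (intro conjI ballI)
    show "I \<noteq> {}" using bound by (auto simp: I_def)
    show "reflp_on I r" "transp_on I r" by (auto simp: r_def reflp_on_def transp_on_def)
    fix p q assume "p \<in> I" "q \<in> I"
    then have "(inf (fst p) (fst q), max (snd p) (snd q)) \<in> I"
      by (auto simp: I_def)
    then show "\<exists>c\<in>I. r p c \<and> r q c"
      by (rule rev_bexI) (auto simp: r_def)
  qed
  have mono: "monotone_on I r (\<ge>) y"
    using inc by (auto simp: monotone_on_def r_def y_def incseq_def intro!: diff_mono)
  have pos: "0 \<le> y p" if "p \<in> I" for p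
    using that by (auto simp: y_def I_def)
  have lower: "w \<le> 0" if w: "\<And>p. p \<in> I \<Longrightarrow> w \<le> y p" for w
  proof -
    have "X n \<le> b - real k *\<^sub>R w" for k n
    proof (induction k arbitrary: n)
      case (Suc k)
      then have "(b - real k *\<^sub>R w, n) \<in> I" by (simp add: I_def)
      from w[OF this] show ?case by (simp add: y_def algebra_simps)
    qed (simp add: bound)
    then have "real k *\<^sub>R w \<le> b - X 0" for k
      by (metis diff_le_eq le_diff_eq add.commute)
    then show ?thesis by (rule order_Archimedean)
  qed
  have "net_decreases_to I r y 0"
    unfolding net_decreases_to_def isGlb_def greatestP_def isLb_def setge_def setle_def
    using dir mono pos lower by auto
  then have "order_converges I r y 0"
  proof (rule order_convergesI)
    fix p assume "p \<in> I"
    then show "\<exists>p0\<in>I. \<forall>q\<in>I. r p0 q \<longrightarrow> \<bar>y q - 0\<bar> \<le> y p"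
      using mono pos by (intro bexI[of _ p]) (simp_all add: monotone_on_def abs_of_nonneg)
  qed
  with oc have null: "norm_null_net I r y" by (rule order_continuousD)
  have "Cauchy X"
  proof (rule metric_CauchyI)
    fix e :: real assume "0 < e"
    with null obtain p where p: "p \<in> I" "\<And>q. q \<in> I \<Longrightarrow> r p q \<Longrightarrow> norm (y q) < e / 2"
      unfolding norm_null_net_def by (metis half_gt_zero)
    have "dist (X m) (X (snd p)) < e / 2" if "snd p \<le> m" for m
    proof -
      have "X (snd p) \<le> X m" "X m \<le> fst p"
        using that inc p(1) by (auto simp: incseq_def I_def)
      then have "norm (X m - X (snd p)) \<le> norm (y p)"
        by (intro norm_mono_banach_lattice) (auto simp: y_def)
      also have "\<dots> < e / 2" using p by (auto simp: r_def)
      finally show ?thesis by (simp add: dist_norm)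
    qed
    then have "dist (X m) (X n) < e" if "snd p \<le> m" "snd p \<le> n" for m n
      using that dist_triangle_half_l by blast
    then show "\<exists>N. \<forall>m\<ge>N. \<forall>n\<ge>N. dist (X m) (X n) < e" by blast
  qed
  then show ?thesis by (rule Cauchy_convergent)
qed

lemma order_bounded_decseq_convergent:
  fixes X :: "nat \<Rightarrow> 'a::banach_lattice"
  assumes "order_continuous TYPE('a)" "decseq X" "\<And>n. b \<le> X n"
  shows "convergent X"
proof -
  have "convergent (\<lambda>n. - X n)"
    using assms by (intro order_bounded_incseq_convergent[where b = "- b"])
      (auto simp: incseq_def decseq_def)
  then show ?thesis using convergent_minus_iff by blast
qed

lemma incseq_le_LIMSEQ:
  fixes X :: "nat \<Rightarrow> 'a::banach_lattice"
  assumes "incseq X" "X \<longlonglongrightarrow> l"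
  shows "X n \<le> l"
  using assms(1)
  by (intro LIMSEQ_le_lattice[OF tendsto_const assms(2)])
     (auto simp: incseq_def eventually_sequentially)

lemma decseq_ge_LIMSEQ:
  fixes X :: "nat \<Rightarrow> 'a::banach_lattice"
  assumes "decseq X" "X \<longlonglongrightarrow> l"
  shows "l \<le> X n"
  using assms(1)
  by (intro LIMSEQ_le_lattice[OF assms(2) tendsto_const])
     (auto simp: decseq_def eventually_sequentially)

text \<open>Order continuity provides a norm limit of the bounded increasing truncations. This limit
  is an upper bound of them, so it is at least their least upper bound \<open>y\<close>.\<close>

lemma weak_unit_tendsto:
  fixes x0 y :: "'a::banach_lattice"
  assumes oc: "order_continuous TYPE('a)" and "weak_unit x0" "0 \<le> y"
  shows "(\<lambda>k. inf y (real k *\<^sub>R x0)) \<longlonglongrightarrow> y"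
proof -
  let ?X = "\<lambda>k. inf y (real k *\<^sub>R x0)"
  have inc: "incseq ?X" and lub: "isLub UNIV (range ?X) y"
    using assms(2,3) by (auto simp: weak_unit_def)
  have "convergent ?X"
    by (rule order_bounded_incseq_convergent[OF oc inc, of y]) simp
  then obtain l where l: "?X \<longlonglongrightarrow> l" by (auto simp: convergent_def)
  have "y \<le> l"
    using lub incseq_le_LIMSEQ[OF inc l]
    by (auto simp: isLub_def leastP_def isUb_def setle_def setge_def)
  moreover have "l \<le> y"
    by (rule LIMSEQ_le_lattice[OF l tendsto_const]) simp
  ultimately show ?thesis using l by simp
qed

text \<open>
  The sequence \<open>e\<close> itself need not be Cauchy: take the partial sums of the unit vectors of \<open>c\<^sub>0\<close>.
\<close>

lemma norm_bounded_incseq_truncated_Cauchy: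
  fixes e :: "nat \<Rightarrow> 'a::banach_lattice"
  assumes oc: "order_continuous TYPE('a)" and inc: "incseq e" and nonneg: "\<And>n. 0 \<le> e n"
    and bound: "\<And>n. norm (e n) \<le> C" and "0 \<le> u" and "0 < \<epsilon>"
  shows "\<exists>N. \<forall>n\<ge>N. \<forall>m\<ge>n. norm (inf (e m - e n) u) \<le> \<epsilon>"
proof -
  have C: "0 \<le> C" using bound[of 0] norm_ge_zero order_trans by blast
  \<comment> \<open>Makes the error \<open>C / r\<close> at most \<open>\<epsilon> / 2\<close>; the
    summand \<open>1\<close> keeps \<open>r\<close> positive if \<open>C = 0\<close>.\<close>
  define r where "r = 2 * (C + 1) / \<epsilon>"
  have r: "0 < r" "C / r \<le> \<epsilon> / 2" using C \<open>0 < \<epsilon>\<close> by (auto simp: r_def field_simps)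
  let ?X = "\<lambda>n. inf (e n) (r *\<^sub>R u)"
  have "incseq ?X" using inc by (auto simp: incseq_def intro: le_infI1)
  then have "convergent ?X" by (intro order_bounded_incseq_convergent[OF oc, of _ "r *\<^sub>R u"]) auto
  then have "Cauchy ?X" by (rule convergent_Cauchy)
  then obtain N where N: "\<And>m n. N \<le> m \<Longrightarrow> N \<le> n \<Longrightarrow> dist (?X m) (?X n) < \<epsilon> / 2"
    using \<open>0 < \<epsilon>\<close> by (meson half_gt_zero metric_CauchyD)
  show ?thesis
  proof (intro exI[of _ N] allI impI)
    fix n m assume nm: "N \<le> n" "n \<le> m"
    have "e n \<le> e m" using inc nm by (auto simp: incseq_def)
    have "norm (inf (e m - e n) u) \<le> norm ((?X m - ?X n) + (1 / r) *\<^sub>R e m)"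
      using \<open>e n \<le> e m\<close> assms(5) nonneg r(1)
      by (intro norm_mono_banach_lattice inf_diff_le) auto
    also have "\<dots> \<le> norm (?X m - ?X n) + norm ((1 / r) *\<^sub>R e m)"
      by (rule norm_triangle_ineq)
    also have "\<dots> \<le> \<epsilon> / 2 + C / r"
      using N[of m n] nm bound[of m] r(1) by (intro add_mono) (auto simp: dist_norm divide_right_mono)
    also have "\<dots> \<le> \<epsilon>" using r(2) by linarith
    finally show "norm (inf (e m - e n) u) \<le> \<epsilon>" .
  qed
qed

section \<open>Order and uo-convergence from dominating vectors of small norm\<close>

text \<open>The dominating vectors for different \<open>e\<close> are unrelated. Their running
  infima \<open>W\<close> decrease, tend to \<open>0\<close> in norm and so have infimum
  \<open>0\<close>, and they still dominate on tails because finitely many tails of a directed set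
  have a common one.\<close>

lemma order_convergesI_norm:
  fixes x :: "'i \<Rightarrow> 'a::banach_lattice"
  assumes dir: "directed_set I r"
    and small: "\<And>e. 0 < e \<Longrightarrow> \<exists>u a0. norm u < e \<and> a0 \<in> I \<and> (\<forall>a\<in>I. r a0 a \<longrightarrow> \<bar>x a - l\<bar> \<le> u)"
  shows "order_converges I r x l"
proof -
  have "\<forall>j::nat. \<exists>u a0. norm u < inverse (real (Suc j)) \<and> a0 \<in> I \<and> (\<forall>a\<in>I. r a0 a \<longrightarrow> \<bar>x a - l\<bar> \<le> u)"
    by (intro allI small) simp
  then obtain u a0 where u: "\<And>j. norm (u j) < inverse (real (Suc j))"
    and a0: "\<And>j. a0 j \<in> I" "\<And>j a. a \<in> I \<Longrightarrow> r (a0 j) a \<Longrightarrow> \<bar>x a - l\<bar> \<le> u j"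
    by metis
  have trans: "r a c" if "a \<in> I" "b \<in> I" "c \<in> I" "r a b" "r b c" for a b c
    using dir that unfolding directed_set_def transp_on_def by blast
  have refl: "r a a" if "a \<in> I" for a
    using dir that by (simp add: directed_set_def reflp_on_def)
  have ub: "\<exists>c\<in>I. r a c \<and> r b c" if "a \<in> I" "b \<in> I" for a b
    using dir that by (simp add: directed_set_def)
  have u_nonneg: "0 \<le> u j" for j
    using a0(2)[OF a0(1) refl[OF a0(1)]] abs_ge_zero order_trans by blast
  define W where "W = rec_nat (u 0) (\<lambda>j w. inf w (u (Suc j)))"
  have W: "W 0 = u 0" "\<And>j. W (Suc j) = inf (W j) (u (Suc j))" by (simp_all add: W_def)
  have W_le: "W j \<le> u j" for j by (cases j) (simp_all add: W)
  have W_nonneg: "0 \<le> W j" for j by (induction j) (simp_all add: W u_nonneg)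
  have W_dec: "decseq W" by (intro decseq_SucI) (simp add: W)
  have W_lim: "W \<longlonglongrightarrow> 0"
  proof (rule Lim_null_comparison[OF _ LIMSEQ_inverse_real_of_nat])
    show "\<forall>\<^sub>F j in sequentially. norm (W j) \<le> inverse (real (Suc j))"
      using norm_mono_banach_lattice[OF W_nonneg W_le] u
      by (intro always_eventually allI) (meson less_imp_le order_trans)
  qed
  have ev: "\<exists>c\<in>I. \<forall>a\<in>I. r c a \<longrightarrow> \<bar>x a - l\<bar> \<le> W j" for j
  proof (induction j)
    case 0
    then show ?case using a0 by (auto simp: W)
  next
    case (Suc j)
    then obtain c where c: "c \<in> I" "\<And>a. a \<in> I \<Longrightarrow> r c a \<Longrightarrow> \<bar>x a - l\<bar> \<le> W j" by blast
    obtain d where "d \<in> I" "r c d" "r (a0 (Suc j)) d" using ub[OF c(1) a0(1)] by blast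
    show ?case
    proof (intro bexI[of _ d] ballI impI)
      fix a assume "a \<in> I" "r d a"
      then have "r c a" "r (a0 (Suc j)) a"
        using trans[OF c(1) \<open>d \<in> I\<close>] trans[OF a0(1) \<open>d \<in> I\<close>] \<open>r c d\<close> \<open>r (a0 (Suc j)) d\<close> by auto
      then show "\<bar>x a - l\<bar> \<le> W (Suc j)"
        using c(2) a0(2) \<open>a \<in> I\<close> by (simp add: W)
    qed fact
  qed
  have "w \<le> 0" if "\<And>j. w \<le> W j" for w
    using LIMSEQ_le_lattice[OF tendsto_const W_lim, of w] that by simp
  then have "net_decreases_to (UNIV :: nat set) (\<le>) W 0"
    unfolding net_decreases_to_def isGlb_def greatestP_def isLb_def setge_def setle_def
      directed_set_def monotone_on_def
    using W_dec W_nonneg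
    by (simp add: decseq_def reflp_on_def transp_on_def) (meson max.cobounded1 max.cobounded2)
  then show ?thesis by (rule order_convergesI) (use ev in simp)
qed

text \<open>A test vector \<open>y\<close> is within small norm of
  \<open>inf y (real k *\<^sub>R x0)\<close>, and passing from truncation at \<open>x0\<close> to
  truncation at a multiple of \<open>x0\<close> costs only the corresponding factor. Hence
  \<open>x0\<close> is the only test vector that matters.\<close>

lemma uo_CauchyI_weak_unit:
  fixes x0 :: "'a::banach_lattice"
  assumes oc: "order_continuous TYPE('a)" and unit: "weak_unit x0"
    and small: "\<And>e. 0 < e \<Longrightarrow>
      \<exists>N u. norm u < e \<and> (\<forall>n\<ge>N. \<forall>m\<ge>N. inf \<bar>x n - x m\<bar> x0 \<le> u)"
  shows "uo_Cauchy x"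
  unfolding uo_Cauchy_def uo_converges_def
proof (intro allI impI order_convergesI_norm)
  let ?r = "\<lambda>p q :: nat \<times> nat. fst p \<le> fst q \<and> snd p \<le> snd q"
  have x0: "0 \<le> x0" using unit by (simp add: weak_unit_def less_imp_le)
  have "\<exists>c. ?r a c \<and> ?r b c" for a b :: "nat \<times> nat"
    by (rule exI[of _ "(max (fst a) (fst b), max (snd a) (snd b))"]) auto
  then show "directed_set UNIV ?r"
    by (auto simp: directed_set_def reflp_on_def transp_on_def)
  fix y :: 'a and e :: real assume y: "0 \<le> y" and e: "0 < e"
  obtain k where k: "norm (inf y (real k *\<^sub>R x0) - y) < e / 2"
    using LIMSEQ_D[OF weak_unit_tendsto[OF oc unit y], of "e / 2"] e by auto
  \<comment> \<open>\<open>Suc k\<close> in place of \<open>k\<close> gives \<open>1 \<le> c\<close>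
    also for \<open>k = 0\<close>, as needed for \<open>?d \<le> c *\<^sub>R ?d\<close> and for the
    division by \<open>c\<close>.\<close>
  define c where "c = real (Suc k)"
  have c: "1 \<le> c" "real k \<le> c" by (auto simp: c_def)
  obtain N u where u: "norm u < e / (2 * c)" "\<And>n m. N \<le> n \<Longrightarrow> N \<le> m \<Longrightarrow> inf \<bar>x n - x m\<bar> x0 \<le> u"
    using small[of "e / (2 * c)"] e c by auto
  let ?v = "c *\<^sub>R u + (y - inf y (real k *\<^sub>R x0))"
  have "norm ?v < e"
  proof -
    have "norm (c *\<^sub>R u) < e / 2" using u(1) c by (simp add: field_simps)
    then show ?thesis
      using norm_triangle_ineq[of "c *\<^sub>R u" "y - inf y (real k *\<^sub>R x0)"] k
      by (simp add: norm_minus_commute)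
  qed
  moreover have "inf \<bar>x n - x m\<bar> y \<le> ?v" if "N \<le> n" "N \<le> m" for n m
  proof -
    let ?d = "\<bar>x n - x m\<bar>" and ?t = "y - inf y (real k *\<^sub>R x0)"
    have t: "0 \<le> ?t" by (simp only: diff_ge_0_iff_ge inf_le1)
    have s: "real k *\<^sub>R x0 \<le> c *\<^sub>R x0" "?d \<le> c *\<^sub>R ?d"
      using c x0 scaleR_right_mono[of "real k" c x0] scaleR_right_mono[of 1 c ?d] by auto
    have "inf ?d y = inf (?t + inf y (real k *\<^sub>R x0)) ?d"
      by (simp only: diff_add_cancel inf_commute)
    also have "\<dots> \<le> ?t + inf (inf y (real k *\<^sub>R x0)) ?d"
      by (rule add_inf_le_of_nonneg[OF t])
    also have "inf (inf y (real k *\<^sub>R x0)) ?d \<le> inf (c *\<^sub>R ?d) (c *\<^sub>R x0)"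
      using s by (meson inf_le1 inf_le2 le_inf_iff order_trans)
    also have "\<dots> = c *\<^sub>R inf ?d x0" using c by (simp add: scaleR_inf)
    also have "\<dots> \<le> c *\<^sub>R u" using u(2)[OF that] c by (intro scaleR_left_mono) auto
    finally show ?thesis by (simp only: add.commute) simp
  qed
  ultimately show "\<exists>v a0. norm v < e \<and> a0 \<in> UNIV \<and> (\<forall>a\<in>UNIV. ?r a0 a \<longrightarrow>
      \<bar>inf \<bar>(case a of (n, m) \<Rightarrow> x n - x m) - 0\<bar> y - 0\<bar> \<le> v)"
    using y by (intro exI[of _ ?v] exI[of _ "(N, N)"]) (auto simp: abs_of_nonneg)
qed

section \<open>Strong measurability\<close>

lemma simple_function_imp_strongly_measurable:
  "simple_function M f \<Longrightarrow> strongly_measurable M f"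
  unfolding strongly_measurable_def by (rule exI[of _ "\<lambda>_. f"]) auto

lemma strongly_measurable_const: "strongly_measurable M (\<lambda>_. c)"
  by (rule simple_function_imp_strongly_measurable) simp

lemma strongly_measurable_compose2:
  assumes f: "strongly_measurable M f" and g: "strongly_measurable M g"
    and p: "continuous_on UNIV (\<lambda>x. p (fst x) (snd x))"
  shows "strongly_measurable M (\<lambda>w. p (f w) (g w))"
proof -
  obtain s t where s: "\<And>i. simple_function M (s i)" "\<And>w. w \<in> space M \<Longrightarrow> (\<lambda>i. s i w) \<longlonglongrightarrow> f w"
    and t: "\<And>i. simple_function M (t i)" "\<And>w. w \<in> space M \<Longrightarrow> (\<lambda>i. t i w) \<longlonglongrightarrow> g w"
    using f g unfolding strongly_measurable_def by metis
  have "(\<lambda>i. p (s i w) (t i w)) \<longlonglongrightarrow> p (f w) (g w)" if "w \<in> space M" for w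
    using continuous_on_tendsto_compose[OF p tendsto_Pair[OF s(2) t(2), OF that that]] by simp
  moreover have "simple_function M (\<lambda>w. p (s i w) (t i w))" for i
    by (rule simple_function_compose2[OF s(1) t(1)])
  ultimately show ?thesis
    unfolding strongly_measurable_def by (intro exI[of _ "\<lambda>i w. p (s i w) (t i w)"]) auto
qed

lemma strongly_measurable_compose:
  assumes "strongly_measurable M f" "continuous_on UNIV p"
  shows "strongly_measurable M (\<lambda>w. p (f w))"
  by (rule strongly_measurable_compose2[OF assms(1,1), of "\<lambda>x _. p x"])
     (rule continuous_on_compose2[OF assms(2) continuous_on_fst[OF continuous_on_id]], simp)

lemma strongly_measurable_add:
  "strongly_measurable M f \<Longrightarrow> strongly_measurable M g \<Longrightarrow> strongly_measurable M (\<lambda>w. f w + g w)"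
  by (rule strongly_measurable_compose2) (auto intro!: continuous_intros)

lemma strongly_measurable_diff:
  "strongly_measurable M f \<Longrightarrow> strongly_measurable M g \<Longrightarrow> strongly_measurable M (\<lambda>w. f w - g w)"
  by (rule strongly_measurable_compose2) (auto intro!: continuous_intros)

lemma strongly_measurable_scaleR:
  "strongly_measurable M f \<Longrightarrow> strongly_measurable M (\<lambda>w. c *\<^sub>R f w)"
  by (rule strongly_measurable_compose) (auto intro!: continuous_intros)

lemma strongly_measurable_indicator_scaleR:
  assumes f: "strongly_measurable M f" and A: "A \<in> sets M"
  shows "strongly_measurable M (\<lambda>w. indicator A w *\<^sub>R f w)"
proof -
  obtain s where s: "\<And>i. simple_function M (s i)" "\<And>w. w \<in> space M \<Longrightarrow> (\<lambda>i. s i w) \<longlonglongrightarrow> f w"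
    using f unfolding strongly_measurable_def by metis
  have "simple_function M (\<lambda>w. (indicator A w :: real) *\<^sub>R s i w)" for i
    by (rule simple_function_compose2[OF simple_function_indicator[OF A] s(1)])
  then show ?thesis
    unfolding strongly_measurable_def using s(2)
    by (intro exI[of _ "\<lambda>i w. indicator A w *\<^sub>R s i w"]) (auto intro!: tendsto_intros)
qed

lemma strongly_measurable_borel:
  assumes "strongly_measurable M f"
  shows "f \<in> borel_measurable M"
proof -
  obtain s where s: "\<And>i. simple_function M (s i)" "\<And>w. w \<in> space M \<Longrightarrow> (\<lambda>i. s i w) \<longlonglongrightarrow> f w"
    using assms unfolding strongly_measurable_def by metis
  show ?thesis
    by (rule borel_measurable_LIMSEQ_metric[OF borel_measurable_simple_function[OF s(1)] s(2)])
qed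

lemma strongly_measurable_norm_borel:
  "strongly_measurable M f \<Longrightarrow> (\<lambda>w. norm (f w)) \<in> borel_measurable M"
  by (rule strongly_measurable_borel[OF strongly_measurable_compose[OF _ continuous_on_norm_id]])

lemma strongly_measurable_subalgebra:
  assumes "strongly_measurable G f" "subalgebra M G"
  shows "strongly_measurable M f"
proof -
  have "simple_function M s" if "simple_function G s" for s :: "'a \<Rightarrow> 'b"
    using that assms(2) by (auto simp: simple_function_def subalgebra_def)
  then show ?thesis
    using assms unfolding strongly_measurable_def subalgebra_def by metis
qed

lemma strongly_measurable_separable_range:
  assumes "strongly_measurable M f"
  shows "\<exists>D. countable D \<and> f ` space M \<subseteq> closure D"
proof -
  obtain s where s: "\<And>i. simple_function M (s i)" "\<And>w. w \<in> space M \<Longrightarrow> (\<lambda>i. s i w) \<longlonglongrightarrow> f w"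
    using assms unfolding strongly_measurable_def by metis
  let ?D = "\<Union>i. s i ` space M"
  have "f w \<in> closure ?D" if "w \<in> space M" for w
    unfolding closure_sequential using s(2)[OF that] that
    by (intro exI[of _ "\<lambda>i. s i w"]) auto
  moreover have "countable ?D"
    using s(1) by (auto simp: simple_function_def intro: countable_finite)
  ultimately show ?thesis by blast
qed

text \<open>This is the converse half of Pettis' measurability theorem. The \<open>i\<close>-th
  approximation is the point nearest to \<open>f w\<close> among the first \<open>i + 1\<close>
  points of an enumeration of \<open>D\<close>; taking the least index of such a point keeps the
  choice measurable.\<close>

lemma strongly_measurableI_separable_range:
  fixes f :: "'w \<Rightarrow> 'b::real_normed_vector"
  assumes [measurable]: "f \<in> borel_measurable M"
    and D: "countable D" "f ` space M \<subseteq> closure D"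
  shows "strongly_measurable M f"
proof (cases "D = {}")
  case True
  then have "space M = {}" using D(2) by auto
  then show ?thesis
    by (intro simple_function_imp_strongly_measurable) (simp add: simple_function_def)
next
  case False
  define e where "e = from_nat_into D"
  have e: "range e = D" unfolding e_def using False D(1) by (rule range_from_nat_into)
  define P where "P i w j \<longleftrightarrow> j \<le> i \<and> (\<forall>l\<le>i. dist (f w) (e j) \<le> dist (f w) (e l))" for i w j
  define k where "k i w = (LEAST j. P i w j)" for i w
  have "\<exists>j. P i w j" for i w
  proof -
    let ?S = "(\<lambda>l. dist (f w) (e l)) ` {..i}"
    have S: "finite ?S" "?S \<noteq> {}" by auto
    obtain j where "Min ?S = dist (f w) (e j)" "j \<in> {..i}"
      using Min_in[OF S] by (rule imageE)
    then have "P i w j" unfolding P_def using Min_le[OF S(1)] by (metis atMost_iff imageI)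
    then show ?thesis by blast
  qed
  then have k: "P i w (k i w)" for i w
    unfolding k_def by (rule LeastI_ex)
  have [measurable]: "(\<lambda>w. dist (f w) c) \<in> borel_measurable M" for c
    by (rule measurable_compose[OF assms(1)], rule borel_measurable_continuous_onI)
       (auto intro!: continuous_intros)
  have [measurable]: "Measurable.pred M (\<lambda>w. P i w j)" for i j
    unfolding P_def by measurable
  have [measurable]: "k i \<in> measurable M (count_space UNIV)" for i
    unfolding k_def by measurable
  have "finite (k i ` space M)" for i
    by (rule finite_subset[of _ "{..i}"]) (use k in \<open>auto simp: P_def\<close>)
  then have "simple_function M (k i)" for i
    by (simp add: simple_function_def)
  then have "simple_function M (\<lambda>w. e (k i w))" for i
    by (rule simple_function_compose1)
  moreover have "(\<lambda>i. e (k i w)) \<longlonglongrightarrow> f w" if "w \<in> space M" for w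
  proof (rule metric_LIMSEQ_I)
    fix r :: real assume "0 < r"
    have "f w \<in> closure D" using D(2) that by auto
    then obtain l where "dist (e l) (f w) < r"
      using \<open>0 < r\<close> e unfolding closure_approachable by (metis imageE)
    then have "dist (e (k i w)) (f w) < r" if "l \<le> i" for i
      using k[of i w] that unfolding P_def by (metis dist_commute le_less_trans)
    then show "\<exists>l. \<forall>i\<ge>l. dist (e (k i w)) (f w) < r" by blast
  qed
  ultimately show ?thesis
    unfolding strongly_measurable_def by (intro exI[of _ "\<lambda>i w. e (k i w)"]) auto
qed

text \<open>A diagonal choice among the simple functions approximating each \<open>f i\<close> need
  not converge everywhere. Borel measurability and separability of the range, on the other hand,
  both pass to the limit.\<close>

lemma strongly_measurable_LIMSEQ:
  assumes f: "\<And>i::nat. strongly_measurable M (f i)"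
    and lim: "\<And>w. w \<in> space M \<Longrightarrow> (\<lambda>i. f i w) \<longlonglongrightarrow> g w"
  shows "strongly_measurable M g"
proof -
  have "\<forall>i. \<exists>D. countable D \<and> f i ` space M \<subseteq> closure D"
    using f strongly_measurable_separable_range by blast
  then obtain D where D: "\<And>i. countable (D i)" "\<And>i. f i ` space M \<subseteq> closure (D i)" by metis
  have "g w \<in> closure (\<Union>i. D i)" if "w \<in> space M" for w
  proof (rule Lim_in_closed_set[OF closed_closure _ _ lim[OF that]])
    have "closure (D i) \<subseteq> closure (\<Union>i. D i)" for i by (intro closure_mono) auto
    then show "\<forall>\<^sub>F i in sequentially. f i w \<in> closure (\<Union>i. D i)"
      using D(2) that by (intro always_eventually) blast
  qed simp
  then have "g ` space M \<subseteq> closure (\<Union>i. D i)" by auto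
  moreover have "g \<in> borel_measurable M"
    by (rule borel_measurable_LIMSEQ_metric[OF strongly_measurable_borel[OF f] lim])
  ultimately show ?thesis
    using D(1) by (intro strongly_measurableI_separable_range[of g M "\<Union>i. D i"]) auto
qed

section \<open>The integral of strongly measurable functions\<close>

context finite_measure
begin

lemma simple_bochner_integrable_finite:
  "simple_function M s \<Longrightarrow> Bochner_Integration.simple_bochner_integrable M s"
  by (rule simple_bochner_integrable.intros) simp_all

lemma integrable_norm_simple_function:
  "simple_function M s \<Longrightarrow> integrable M (\<lambda>w. norm (s w))"
  by (rule integrable_simple_function) (auto intro: simple_function_compose1)

lemma norm_simple_bochner_integral_le:
  assumes "simple_function M s"
  shows "norm (Bochner_Integration.simple_bochner_integral M s) \<le> (LINT w|M. norm (s w))"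
proof -
  have "simple_function M (\<lambda>w. norm (s w))"
    using assms by (rule simple_function_compose1)
  then show ?thesis
    using simple_bochner_integral_norm_bound[OF simple_bochner_integrable_finite[OF assms]]
      simple_bochner_integrable_eq_integral[OF simple_bochner_integrable_finite]
    by metis
qed

lemma integrable_norm_diff:
  assumes "strongly_measurable M f" "strongly_measurable M g"
    and "integrable M (\<lambda>w. norm (f w))" "integrable M (\<lambda>w. norm (g w))"
  shows "integrable M (\<lambda>w. norm (f w - g w))"
proof (rule Bochner_Integration.integrable_bound[OF Bochner_Integration.integrable_add[OF assms(3,4)]])
  show "(\<lambda>w. norm (f w - g w)) \<in> borel_measurable M"
    by (rule strongly_measurable_norm_borel[OF strongly_measurable_diff[OF assms(1,2)]])
qed (auto simp: norm_triangle_ineq4)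

text \<open>The \<open>ennreal\<close> integrals become real ones once \<open>norm f\<close> is
  integrable. It is, because some integrable simple function has \<open>L1\<close> distance less
  than \<open>1\<close> from \<open>f\<close>.\<close>

lemma has_strong_integral_real:
  "has_strong_integral M f x \<longleftrightarrow> strongly_measurable M f \<and> integrable M (\<lambda>w. norm (f w)) \<and>
     (\<exists>s. (\<forall>i::nat. simple_function M (s i)) \<and> (\<lambda>i. LINT w|M. norm (f w - s i w)) \<longlonglongrightarrow> 0 \<and>
          (\<lambda>i. Bochner_Integration.simple_bochner_integral M (s i)) \<longlonglongrightarrow> x)"
proof -
  have meas: "(\<lambda>w. norm (f w - s w)) \<in> borel_measurable M"
    if "strongly_measurable M f" "simple_function M s" for s
    by (intro strongly_measurable_norm_borel strongly_measurable_diff that(1)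
        simple_function_imp_strongly_measurable[OF that(2)])
  have eq: "(\<integral>\<^sup>+w. norm (f w - s w) \<partial>M) = ennreal (LINT w|M. norm (f w - s w))"
    if "strongly_measurable M f" "simple_function M s" "integrable M (\<lambda>w. norm (f w))" for s
    by (intro nn_integral_eq_integral integrable_norm_diff that
        integrable_norm_simple_function[OF that(2)]
        simple_function_imp_strongly_measurable[OF that(2)]) auto
  have simple: "Bochner_Integration.simple_bochner_integrable M s \<longleftrightarrow> simple_function M s" for s :: "'a \<Rightarrow> 'b"
    using simple_bochner_integrable_finite by (auto elim: simple_bochner_integrable.cases)
  have int: "integrable M (\<lambda>w. norm (f w))"
    if f: "strongly_measurable M f" and s: "\<And>i::nat. simple_function M (s i)"
      and lim: "(\<lambda>i. \<integral>\<^sup>+w. norm (f w - s i w) \<partial>M) \<longlonglongrightarrow> 0" for s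
  proof -
    obtain i where "(\<integral>\<^sup>+w. norm (f w - s i w) \<partial>M) < 1"
      using order_tendstoD(2)[OF lim, of 1] by (auto simp: eventually_sequentially)
    then have "(\<integral>\<^sup>+w. norm (f w - s i w) \<partial>M) < \<infinity>"
      by (metis ennreal_one_less_top infinity_ennreal_def order.strict_trans)
    then have "integrable M (\<lambda>w. norm (f w - s i w))"
      using meas[OF f s] by (intro integrableI_bounded) auto
    then show ?thesis
    proof (rule Bochner_Integration.integrable_bound[OF Bochner_Integration.integrable_add[OF _
            integrable_norm_simple_function[OF s[of i]]]])
      show "AE w in M. norm (norm (f w)) \<le> norm (norm (f w - s i w) + norm (s i w))"
        using norm_triangle_sub by (auto simp: add.commute)
    qed (intro strongly_measurable_norm_borel f)
  qed
  show ?thesis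
    unfolding has_strong_integral_def simple
    using int eq by (auto simp: ennreal_tendsto_0_iff[symmetric]) (metis (no_types, lifting) ext)+
qed

lemma has_strong_integral_simple:
  assumes "simple_function M s"
  shows "has_strong_integral M s (Bochner_Integration.simple_bochner_integral M s)"
  unfolding has_strong_integral_real using assms
  by (auto intro!: exI[of _ "\<lambda>_. s"] simp: simple_function_imp_strongly_measurable integrable_norm_simple_function)

lemma has_strong_integral_add:
  assumes "has_strong_integral M f x" "has_strong_integral M g y"
  shows "has_strong_integral M (\<lambda>w. f w + g w) (x + y)"
proof -
  obtain s where f: "strongly_measurable M f" "integrable M (\<lambda>w. norm (f w))"
    and s: "\<And>i. simple_function M (s i)" "(\<lambda>i. LINT w|M. norm (f w - s i w)) \<longlonglongrightarrow> 0"
      "(\<lambda>i. Bochner_Integration.simple_bochner_integral M (s i)) \<longlonglongrightarrow> x"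
    using assms(1) unfolding has_strong_integral_real by blast
  obtain t where g: "strongly_measurable M g" "integrable M (\<lambda>w. norm (g w))"
    and t: "\<And>i. simple_function M (t i)" "(\<lambda>i. LINT w|M. norm (g w - t i w)) \<longlonglongrightarrow> 0"
      "(\<lambda>i. Bochner_Integration.simple_bochner_integral M (t i)) \<longlonglongrightarrow> y"
    using assms(2) unfolding has_strong_integral_real by blast
  have fg: "strongly_measurable M (\<lambda>w. f w + g w)" by (intro strongly_measurable_add f g)
  have st: "simple_function M (\<lambda>w. s i w + t i w)" for i
    by (rule simple_function_compose2[OF s(1) t(1)])
  have int: "integrable M (\<lambda>w. norm (f w + g w))"
    by (rule Bochner_Integration.integrable_bound[OF Bochner_Integration.integrable_add[OF f(2) g(2)]])
       (auto intro: strongly_measurable_norm_borel fg simp: norm_triangle_ineq)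
  have "(\<lambda>i. LINT w|M. norm (f w + g w - (s i w + t i w))) \<longlonglongrightarrow> 0"
  proof (rule tendsto_sandwich[OF _ _ tendsto_const])
    show "(\<lambda>i. (LINT w|M. norm (f w - s i w)) + (LINT w|M. norm (g w - t i w))) \<longlonglongrightarrow> 0"
      using tendsto_add[OF s(2) t(2)] by simp
    show "\<forall>\<^sub>F i in sequentially. (LINT w|M. norm (f w + g w - (s i w + t i w)))
        \<le> (LINT w|M. norm (f w - s i w)) + (LINT w|M. norm (g w - t i w))"
    proof (intro always_eventually allI)
      fix i
      have i: "integrable M (\<lambda>w. norm (f w - s i w))" "integrable M (\<lambda>w. norm (g w - t i w))"
        "integrable M (\<lambda>w. norm (f w + g w - (s i w + t i w)))"
        by (intro integrable_norm_diff f(1,2) g(1,2) fg int integrable_norm_simple_function[OF s(1)]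
            integrable_norm_simple_function[OF t(1)] integrable_norm_simple_function[OF st]
            simple_function_imp_strongly_measurable[OF s(1)]
            simple_function_imp_strongly_measurable[OF t(1)]
            simple_function_imp_strongly_measurable[OF st])+
      show "(LINT w|M. norm (f w + g w - (s i w + t i w)))
        \<le> (LINT w|M. norm (f w - s i w)) + (LINT w|M. norm (g w - t i w))"
        unfolding Bochner_Integration.integral_add[OF i(1,2), symmetric]
        by (intro integral_mono i Bochner_Integration.integrable_add norm_diff_triangle_ineq)
    qed
  qed simp
  moreover have "(\<lambda>i. Bochner_Integration.simple_bochner_integral M (\<lambda>w. s i w + t i w)) \<longlonglongrightarrow> x + y"
    using tendsto_add[OF s(3) t(3)] s(1) t(1)
    by (simp add: simple_bochner_integral_add simple_bochner_integrable_finite)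
  ultimately show ?thesis
    unfolding has_strong_integral_real using fg int st
    by (intro conjI exI[of _ "\<lambda>i w. s i w + t i w"]) auto
qed

lemma has_strong_integral_scaleR:
  assumes "has_strong_integral M f x"
  shows "has_strong_integral M (\<lambda>w. c *\<^sub>R f w) (c *\<^sub>R x)"
proof -
  obtain s where f: "strongly_measurable M f" "integrable M (\<lambda>w. norm (f w))"
    and s: "\<And>i. simple_function M (s i)" "(\<lambda>i. LINT w|M. norm (f w - s i w)) \<longlonglongrightarrow> 0"
      "(\<lambda>i. Bochner_Integration.simple_bochner_integral M (s i)) \<longlonglongrightarrow> x"
    using assms(1) unfolding has_strong_integral_real by blast
  have "(\<lambda>i. LINT w|M. norm (c *\<^sub>R f w - c *\<^sub>R s i w)) \<longlonglongrightarrow> 0"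
    using tendsto_mult_right_zero[OF s(2), of "\<bar>c\<bar>"] by (simp add: scaleR_diff_right[symmetric])
  moreover have "(\<lambda>i. Bochner_Integration.simple_bochner_integral M (\<lambda>w. c *\<^sub>R s i w)) \<longlonglongrightarrow> c *\<^sub>R x"
    using tendsto_scaleR[OF tendsto_const s(3)] s(1)
    by (subst simple_bochner_integral_linear)
       (auto simp: simple_bochner_integrable_finite bounded_linear.linear[OF bounded_linear_scaleR_right])
  ultimately show ?thesis
    unfolding has_strong_integral_real using f s(1)
    by (intro conjI exI[of _ "\<lambda>i w. c *\<^sub>R s i w"])
       (auto intro: strongly_measurable_scaleR simple_function_compose1)
qed

lemma has_strong_integral_diff:
  assumes "has_strong_integral M f x" "has_strong_integral M g y"
  shows "has_strong_integral M (\<lambda>w. f w - g w) (x - y)"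
  using has_strong_integral_add[OF assms(1) has_strong_integral_scaleR[OF assms(2), of "-1"]] by simp

lemma has_strong_integral_norm_le:
  assumes "has_strong_integral M f x"
  shows "norm x \<le> (LINT w|M. norm (f w))"
proof -
  obtain s where f: "strongly_measurable M f" "integrable M (\<lambda>w. norm (f w))"
    and s: "\<And>i. simple_function M (s i)" "(\<lambda>i. LINT w|M. norm (f w - s i w)) \<longlonglongrightarrow> 0"
      "(\<lambda>i. Bochner_Integration.simple_bochner_integral M (s i)) \<longlonglongrightarrow> x"
    using assms(1) unfolding has_strong_integral_real by blast
  have "norm (Bochner_Integration.simple_bochner_integral M (s i))
      \<le> (LINT w|M. norm (f w)) + (LINT w|M. norm (f w - s i w))" for i
  proof -
    have i: "integrable M (\<lambda>w. norm (f w - s i w))"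
      by (intro integrable_norm_diff f(1,2) integrable_norm_simple_function s(1)
          simple_function_imp_strongly_measurable[OF s(1)])
    have "norm (Bochner_Integration.simple_bochner_integral M (s i)) \<le> (LINT w|M. norm (s i w))"
      by (rule norm_simple_bochner_integral_le[OF s(1)])
    also have "\<dots> \<le> (LINT w|M. norm (f w) + norm (f w - s i w))"
      by (intro integral_mono integrable_norm_simple_function[OF s(1)] Bochner_Integration.integrable_add f i)
         (metis norm_minus_commute norm_triangle_sub)
    finally show ?thesis using f i by simp
  qed
  then show ?thesis
    using LIMSEQ_le[OF tendsto_norm[OF s(3)] tendsto_add[OF tendsto_const s(2)]] by auto
qed

lemma has_strong_integral_unique:
  assumes "has_strong_integral M f x" "has_strong_integral M f y"
  shows "x = y"
  using has_strong_integral_norm_le[OF has_strong_integral_diff[OF assms]] by simp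

lemma strong_integral_eqI: "has_strong_integral M f x \<Longrightarrow> strong_integral M f = x"
  unfolding strong_integral_def by (rule the_equality) (auto intro: has_strong_integral_unique)

lemma has_strong_integral_strong_integral:
  "f \<in> L1 M \<Longrightarrow> has_strong_integral M f (strong_integral M f)"
  unfolding L1_def using strong_integral_eqI by auto

lemma simple_approximation_L1:
  assumes f: "strongly_measurable M f" and int: "integrable M (\<lambda>w. norm (f w))"
  shows "\<exists>s. (\<forall>i::nat. simple_function M (s i)) \<and> (\<lambda>i. LINT w|M. norm (f w - s i w)) \<longlonglongrightarrow> 0"
proof -
  obtain s where s: "\<And>i. simple_function M (s i)" "\<And>w. w \<in> space M \<Longrightarrow> (\<lambda>i. s i w) \<longlonglongrightarrow> f w"
    using f unfolding strongly_measurable_def by metis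
  \<comment> \<open>Cutting \<open>s i\<close> off where it exceeds \<open>2 * norm (f w)\<close>
    makes the sequence dominated. Convergence survives: for \<open>f w \<noteq> 0\<close> the
    cut-off is eventually inactive because \<open>2 > 1\<close>, and for \<open>f w = 0\<close> all
    \<open>t i w\<close> vanish.\<close>
  define A where "A i = {w \<in> space M. norm (s i w) \<le> 2 * norm (f w)}" for i
  define t where "t i w = indicat_real (A i) w *\<^sub>R s i w" for i w
  have [measurable]: "f \<in> borel_measurable M" "\<And>i. s i \<in> borel_measurable M"
    using s(1) by (auto intro: strongly_measurable_borel f borel_measurable_simple_function)
  have "A i \<in> sets M" for i
    unfolding A_def by measurable
  then have t: "simple_function M (t i)" for i
    unfolding t_def by (intro simple_function_compose2[OF simple_function_indicator s(1)])
  have t_le: "norm (t i w) \<le> 2 * norm (f w)" for i w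
    by (auto simp: t_def A_def indicator_def)
  have t_lim: "(\<lambda>i. norm (f w - t i w)) \<longlonglongrightarrow> 0" if w: "w \<in> space M" for w
  proof (cases "f w = 0")
    case True
    then show ?thesis using t_le[of _ w] by simp
  next
    case False
    then have "\<forall>\<^sub>F i in sequentially. norm (s i w) < 2 * norm (f w)"
      by (intro order_tendstoD(2)[OF tendsto_norm[OF s(2)[OF w]]]) simp
    then have "\<forall>\<^sub>F i in sequentially. t i w = s i w"
      by eventually_elim (simp add: t_def A_def w)
    then have "(\<lambda>i. t i w) \<longlonglongrightarrow> f w"
      using s(2)[OF w] by (simp add: tendsto_cong)
    then show ?thesis
      using tendsto_norm_zero[OF LIM_zero, of "\<lambda>i. t i w"] by (simp add: norm_minus_commute)
  qed
  have "(\<lambda>i. LINT w|M. norm (f w - t i w)) \<longlonglongrightarrow> (LINT w|M. 0)"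
  proof (rule integral_dominated_convergence[where w = "\<lambda>w. 3 * norm (f w)"])
    show "AE w in M. norm (norm (f w - t i w)) \<le> 3 * norm (f w)" for i
    proof (intro always_eventually allI)
      fix w show "norm (norm (f w - t i w)) \<le> 3 * norm (f w)"
        using norm_triangle_ineq4[of "f w" "t i w"] t_le[of i w] by simp
    qed
    show "(\<lambda>w. norm (f w - t i w)) \<in> borel_measurable M" for i
      by (intro strongly_measurable_norm_borel strongly_measurable_diff f(1)
          simple_function_imp_strongly_measurable[OF t])
  qed (use t_lim int in auto)
  then show ?thesis using t by (intro exI[of _ t]) simp
qed

text \<open>Completeness of the range enters here: the integrals of an \<open>L1\<close>
  approximation by simple functions form a Cauchy sequence and therefore have a limit.\<close>

lemma L1_iff:
  fixes f :: "'a \<Rightarrow> 'b::banach"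
  shows "f \<in> L1 M \<longleftrightarrow> strongly_measurable M f \<and> integrable M (\<lambda>w. norm (f w))"
proof
  assume "strongly_measurable M f \<and> integrable M (\<lambda>w. norm (f w))"
  then have f: "strongly_measurable M f" "integrable M (\<lambda>w. norm (f w))" by auto
  obtain s where s: "\<And>i::nat. simple_function M (s i)" "(\<lambda>i. LINT w|M. norm (f w - s i w)) \<longlonglongrightarrow> 0"
    using simple_approximation_L1[OF f] by blast
  let ?I = "Bochner_Integration.simple_bochner_integral M"
  let ?a = "\<lambda>i. LINT w|M. norm (f w - s i w)"
  have le: "dist (?I (s i)) (?I (s j)) \<le> ?a i + ?a j" for i j
  proof -
    have i: "integrable M (\<lambda>w. norm (f w - s i w))" for i
      by (intro integrable_norm_diff f(1,2) integrable_norm_simple_function s(1)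
          simple_function_imp_strongly_measurable[OF s(1)])
    have sf: "simple_function M (\<lambda>w. s i w - s j w)"
      by (rule simple_function_compose2[OF s(1) s(1)])
    have "dist (?I (s i)) (?I (s j)) = norm (?I (\<lambda>w. s i w - s j w))"
      by (simp add: dist_norm simple_bochner_integral_diff simple_bochner_integrable_finite s(1))
    also have "\<dots> \<le> (LINT w|M. norm (s i w - s j w))"
      by (rule norm_simple_bochner_integral_le[OF sf])
    also have "\<dots> \<le> (LINT w|M. norm (f w - s i w) + norm (f w - s j w))"
    proof (intro integral_mono integrable_norm_simple_function[OF sf] Bochner_Integration.integrable_add i)
      fix w show "norm (s i w - s j w) \<le> norm (f w - s i w) + norm (f w - s j w)"
        using norm_triangle_ineq4[of "f w - s j w" "f w - s i w"] by simp
    qed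
    finally show ?thesis using i by simp
  qed
  have "Cauchy (\<lambda>i. ?I (s i))"
  proof (rule metric_CauchyI)
    fix e :: real assume "0 < e"
    then obtain N where N: "\<And>i. N \<le> i \<Longrightarrow> ?a i < e / 2"
      using order_tendstoD(2)[OF s(2), of "e / 2"] by (auto simp: eventually_sequentially)
    have "dist (?I (s i)) (?I (s j)) < e" if "N \<le> i" "N \<le> j" for i j
      using le[of i j] N[OF that(1)] N[OF that(2)] by simp
    then show "\<exists>N. \<forall>i\<ge>N. \<forall>j\<ge>N. dist (?I (s i)) (?I (s j)) < e" by blast
  qed
  then obtain x where "(\<lambda>i. ?I (s i)) \<longlonglongrightarrow> x"
    using Cauchy_convergent unfolding convergent_def by blast
  then have "has_strong_integral M f x"
    unfolding has_strong_integral_real using f s by blast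
  then show "f \<in> L1 M" by (auto simp: L1_def)
qed (auto simp: L1_def has_strong_integral_real)

lemma L1_strongly_measurable:
  fixes f :: "'a \<Rightarrow> 'b::banach"
  shows "f \<in> L1 M \<Longrightarrow> strongly_measurable M f"
  by (simp add: L1_iff)

lemma L1_integrable_norm:
  fixes f :: "'a \<Rightarrow> 'b::banach"
  shows "f \<in> L1 M \<Longrightarrow> integrable M (\<lambda>w. norm (f w))"
  by (simp add: L1_iff)

lemma L1_bound:
  fixes f :: "'a \<Rightarrow> 'b::banach" and g :: "'a \<Rightarrow> 'c::banach"
  assumes "g \<in> L1 M" "strongly_measurable M f" "AE w in M. norm (f w) \<le> norm (g w)"
  shows "f \<in> L1 M"
  unfolding L1_iff
proof
  show "integrable M (\<lambda>w. norm (f w))"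
    by (rule Bochner_Integration.integrable_bound[OF L1_integrable_norm[OF assms(1)]])
       (use assms(3) strongly_measurable_norm_borel[OF assms(2)] in auto)
qed fact

lemma L1_const: "(\<lambda>_. c) \<in> L1 M"
  for c :: "'b::banach"
  by (simp add: L1_iff strongly_measurable_const)

lemma L1_add:
  fixes f :: "'a \<Rightarrow> 'b::banach"
  shows "f \<in> L1 M \<Longrightarrow> g \<in> L1 M \<Longrightarrow> (\<lambda>w. f w + g w) \<in> L1 M"
  unfolding L1_def using has_strong_integral_add by blast

lemma L1_diff:
  fixes f :: "'a \<Rightarrow> 'b::banach"
  shows "f \<in> L1 M \<Longrightarrow> g \<in> L1 M \<Longrightarrow> (\<lambda>w. f w - g w) \<in> L1 M"
  unfolding L1_def using has_strong_integral_diff by blast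

lemma L1_scaleR:
  fixes f :: "'a \<Rightarrow> 'b::banach"
  shows "f \<in> L1 M \<Longrightarrow> (\<lambda>w. c *\<^sub>R f w) \<in> L1 M"
  unfolding L1_def using has_strong_integral_scaleR by blast

lemma L1_indicator:
  fixes f :: "'a \<Rightarrow> 'b::banach"
  assumes "f \<in> L1 M" "A \<in> sets M"
  shows "(\<lambda>w. indicator A w *\<^sub>R f w) \<in> L1 M"
  by (rule L1_bound[OF assms(1) strongly_measurable_indicator_scaleR[OF L1_strongly_measurable]])
     (use assms in \<open>auto simp: indicator_def\<close>)

lemma L1_sum:
  fixes f :: "'i \<Rightarrow> 'a \<Rightarrow> 'b::banach"
  assumes "\<And>i. i \<in> I \<Longrightarrow> f i \<in> L1 M"
  shows "(\<lambda>w. \<Sum>i\<in>I. f i w) \<in> L1 M"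
  using assms by (induction I rule: infinite_finite_induct) (auto intro: L1_add L1_const)

lemma L1_pprt:
  fixes f :: "'a \<Rightarrow> 'b::banach_lattice"
  assumes "f \<in> L1 M"
  shows "(\<lambda>w. pprt (f w)) \<in> L1 M"
  by (rule L1_bound[OF assms strongly_measurable_compose[OF L1_strongly_measurable[OF assms] continuous_on_pprt]])
     (simp add: norm_pprt_le)

lemma L1_sup:
  fixes f :: "'a \<Rightarrow> 'b::banach_lattice"
  shows "f \<in> L1 M \<Longrightarrow> g \<in> L1 M \<Longrightarrow> (\<lambda>w. sup (f w) (g w)) \<in> L1 M"
  unfolding sup_eq_pprt by (intro L1_add L1_pprt L1_diff)

lemma L1_inf:
  fixes f :: "'a \<Rightarrow> 'b::banach_lattice"
  shows "f \<in> L1 M \<Longrightarrow> g \<in> L1 M \<Longrightarrow> (\<lambda>w. inf (f w) (g w)) \<in> L1 M"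
  unfolding inf_eq_pprt by (intro L1_diff L1_pprt)

lemma L1_abs:
  fixes f :: "'a \<Rightarrow> 'b::banach_lattice"
  assumes "f \<in> L1 M"
  shows "(\<lambda>w. \<bar>f w\<bar>) \<in> L1 M"
  using L1_sup[OF assms L1_scaleR[OF assms, of "-1"]] by (simp add: abs_lattice)

lemma strong_integral_add:
  fixes f :: "'a \<Rightarrow> 'b::banach"
  shows "f \<in> L1 M \<Longrightarrow> g \<in> L1 M \<Longrightarrow>
    strong_integral M (\<lambda>w. f w + g w) = strong_integral M f + strong_integral M g"
  by (intro strong_integral_eqI has_strong_integral_add has_strong_integral_strong_integral)

lemma strong_integral_diff:
  fixes f :: "'a \<Rightarrow> 'b::banach"
  shows "f \<in> L1 M \<Longrightarrow> g \<in> L1 M \<Longrightarrow>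
    strong_integral M (\<lambda>w. f w - g w) = strong_integral M f - strong_integral M g"
  by (intro strong_integral_eqI has_strong_integral_diff has_strong_integral_strong_integral)

lemma strong_integral_scaleR:
  fixes f :: "'a \<Rightarrow> 'b::banach"
  shows "f \<in> L1 M \<Longrightarrow> strong_integral M (\<lambda>w. c *\<^sub>R f w) = c *\<^sub>R strong_integral M f"
  by (intro strong_integral_eqI has_strong_integral_scaleR has_strong_integral_strong_integral)

lemma strong_integral_indicator_const:
  assumes "A \<in> sets M"
  shows "strong_integral M (\<lambda>w. indicator A w *\<^sub>R c) = measure M A *\<^sub>R (c :: 'b::banach)"
proof (rule strong_integral_eqI)
  have "simple_function M (indicat_real A)" using assms by simp
  note A = this simple_bochner_integrable_finite[OF this]
  have "simple_function M (\<lambda>w. indicat_real A w *\<^sub>R c)"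
    using A(1) by (rule simple_function_compose1)
  from has_strong_integral_simple[OF this]
  show "has_strong_integral M (\<lambda>w. indicat_real A w *\<^sub>R c) (measure M A *\<^sub>R c)"
    using simple_bochner_integral_linear[OF bounded_linear.linear[OF bounded_linear_scaleR_left] A(2), of c]
      simple_bochner_integrable_eq_integral[OF A(2)] assms
    by simp
qed

lemma strong_integral_const:
  "strong_integral M (\<lambda>_. c) = measure M (space M) *\<^sub>R (c :: 'b::banach)"
proof -
  have "strong_integral M (\<lambda>w. indicator (space M) w *\<^sub>R c) = measure M (space M) *\<^sub>R c"
    by (rule strong_integral_indicator_const) simp
  moreover have "has_strong_integral M (\<lambda>_. c) x"
    if "has_strong_integral M (\<lambda>w. indicator (space M) w *\<^sub>R c) x" for x
    using that unfolding has_strong_integral_real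
    by (simp add: strongly_measurable_const cong: Bochner_Integration.integral_cong)
  ultimately show ?thesis
    using has_strong_integral_strong_integral[OF L1_indicator[OF L1_const, of "space M" c]]
    by (intro strong_integral_eqI) auto
qed

lemma norm_strong_integral_le:
  fixes f :: "'a \<Rightarrow> 'b::banach"
  shows "f \<in> L1 M \<Longrightarrow> norm (strong_integral M f) \<le> (LINT w|M. norm (f w))"
  by (rule has_strong_integral_norm_le[OF has_strong_integral_strong_integral])

text \<open>The positive parts of the simple approximations approximate \<open>f\<close> at least as
  well, since \<open>pprt\<close> is 1-Lipschitz and fixes \<open>f\<close> almost everywhere. Their
  integrals lie in the closed positive cone.\<close>

lemma strong_integral_nonneg_AE:
  fixes f :: "'a \<Rightarrow> 'b::banach_lattice"
  assumes f: "f \<in> L1 M" and nonneg: "AE w in M. 0 \<le> f w"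
  shows "0 \<le> strong_integral M f"
proof -
  note sm = L1_strongly_measurable[OF f] L1_integrable_norm[OF f]
  let ?I = "Bochner_Integration.simple_bochner_integral M"
  obtain s where s: "\<And>i::nat. simple_function M (s i)" "(\<lambda>i. LINT w|M. norm (f w - s i w)) \<longlonglongrightarrow> 0"
    using simple_approximation_L1[OF sm] by blast
  define t where "t i w = pprt (s i w)" for i w
  have t: "simple_function M (t i)" for i
    unfolding t_def using s(1) by (rule simple_function_compose1)
  have le: "norm (strong_integral M f - ?I (t i)) \<le> (LINT w|M. norm (f w - s i w))" for i
  proof -
    have "norm (strong_integral M f - ?I (t i)) \<le> (LINT w|M. norm (f w - t i w))"
      by (intro has_strong_integral_norm_le has_strong_integral_diff
          has_strong_integral_strong_integral f has_strong_integral_simple t)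
    also have "\<dots> \<le> (LINT w|M. norm (f w - s i w))"
    proof (intro integral_mono_AE integrable_norm_diff sm integrable_norm_simple_function[OF s(1)]
        integrable_norm_simple_function[OF t] simple_function_imp_strongly_measurable[OF s(1)]
        simple_function_imp_strongly_measurable[OF t])
      show "AE w in M. norm (f w - t i w) \<le> norm (f w - s i w)"
        using nonneg
      proof eventually_elim
        case (elim w)
        then show ?case
          using norm_pprt_diff_le[of "f w" "s i w"] by (simp add: t_def)
      qed
    qed
    finally show ?thesis .
  qed
  have "(\<lambda>i. ?I (t i)) \<longlonglongrightarrow> strong_integral M f"
    by (rule LIM_zero_cancel, rule Lim_null_comparison[OF _ s(2)])
       (use le in \<open>simp add: norm_minus_commute\<close>)
  then show ?thesis
  proof (rule LIMSEQ_nonneg)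
    show "\<forall>\<^sub>F i in sequentially. 0 \<le> ?I (t i)"
      unfolding simple_bochner_integral_def
      by (intro always_eventually allI sum_nonneg scaleR_nonneg_nonneg) (auto simp: t_def)
  qed
qed

lemma strong_integral_mono_AE:
  fixes f :: "'a \<Rightarrow> 'b::banach_lattice"
  assumes "f \<in> L1 M" "g \<in> L1 M" "AE w in M. f w \<le> g w"
  shows "strong_integral M f \<le> strong_integral M g"
  using strong_integral_nonneg_AE[OF L1_diff[OF assms(2,1)]] assms
  by (simp add: strong_integral_diff)

lemma strong_integral_cong_AE:
  fixes f :: "'a \<Rightarrow> 'b::banach_lattice"
  assumes "f \<in> L1 M" "g \<in> L1 M" "AE w in M. f w = g w"
  shows "strong_integral M f = strong_integral M g"
  using assms by (intro antisym strong_integral_mono_AE) auto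

lemma strong_integral_sum:
  fixes f :: "'i \<Rightarrow> 'a \<Rightarrow> 'b::banach_lattice"
  assumes "\<And>i. i \<in> I \<Longrightarrow> f i \<in> L1 M"
  shows "strong_integral M (\<lambda>w. \<Sum>i\<in>I. f i w) = (\<Sum>i\<in>I. strong_integral M (f i))"
  using assms
  by (induction I rule: infinite_finite_induct)
     (auto simp: strong_integral_add L1_sum strong_integral_const)

lemma strong_integral_inf_le:
  fixes f :: "'a \<Rightarrow> 'b::banach_lattice"
  assumes "f \<in> L1 M" "g \<in> L1 M"
  shows "strong_integral M (\<lambda>w. inf (f w) (g w)) \<le> inf (strong_integral M f) (strong_integral M g)"
  using assms by (simp add: strong_integral_mono_AE L1_inf)

lemma strong_integral_bounded_convergence:
  fixes f :: "nat \<Rightarrow> 'a \<Rightarrow> 'b::banach"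
  assumes f: "\<And>i. strongly_measurable M (f i)" and bound: "\<And>i w. norm (f i w) \<le> B"
    and lim: "\<And>w. (\<lambda>i. f i w) \<longlonglongrightarrow> g w"
  shows "g \<in> L1 M" "(\<lambda>i. strong_integral M (f i)) \<longlonglongrightarrow> strong_integral M g"
proof -
  have g: "strongly_measurable M g"
    by (rule strongly_measurable_LIMSEQ[OF f lim])
  have g_bound: "norm (g w) \<le> B" for w
    by (rule LIMSEQ_le_const2[OF tendsto_norm[OF lim]]) (use bound in auto)
  have bounded_L1: "h \<in> L1 M" if "strongly_measurable M h" "\<And>w. norm (h w) \<le> B" for h :: "'a \<Rightarrow> 'b"
    unfolding L1_iff using that
    by (auto intro!: integrable_const_bound[where B = B] strongly_measurable_norm_borel)
  show gL: "g \<in> L1 M" by (rule bounded_L1[OF g g_bound])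
  have fL: "f i \<in> L1 M" for i by (rule bounded_L1[OF f bound])
  have "(\<lambda>i. LINT w|M. norm (f i w - g w)) \<longlonglongrightarrow> (LINT w|M. 0)"
  proof (rule integral_dominated_convergence[where w = "\<lambda>_. 2 * B"])
    show "AE w in M. norm (norm (f i w - g w)) \<le> 2 * B" for i
    proof (intro always_eventually allI)
      fix w show "norm (norm (f i w - g w)) \<le> 2 * B"
        using norm_triangle_ineq4[of "f i w" "g w"] bound[of i w] g_bound[of w] by simp
    qed
    show "AE w in M. (\<lambda>i. norm (f i w - g w)) \<longlonglongrightarrow> 0"
      using lim by (intro always_eventually allI tendsto_norm_zero LIM_zero)
    show "(\<lambda>w. norm (f i w - g w)) \<in> borel_measurable M" for i
      by (intro strongly_measurable_norm_borel strongly_measurable_diff f g)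
  qed auto
  then have *: "(\<lambda>i. LINT w|M. norm (f i w - g w)) \<longlonglongrightarrow> 0" by simp
  show "(\<lambda>i. strong_integral M (f i)) \<longlonglongrightarrow> strong_integral M g"
  proof (rule LIM_zero_cancel, rule Lim_null_comparison[OF _ *])
    show "\<forall>\<^sub>F i in sequentially. norm (strong_integral M (f i) - strong_integral M g)
        \<le> (LINT w|M. norm (f i w - g w))"
      using norm_strong_integral_le[OF L1_diff[OF fL gL]]
      by (simp add: strong_integral_diff fL gL)
  qed
qed

text \<open>
  The averages of \<open>h\<close> over the preimages of small balls lie near the centres of these balls, so a
  ball away from the closed positive cone has a null preimage; by separability of the range countably
  many balls suffice.
\<close>

lemma AE_nonneg_if_set_integrals_nonneg:
  fixes h :: "'a \<Rightarrow> 'b::banach_lattice"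
  assumes sub: "subalgebra M G" and hG: "strongly_measurable G h" and h: "h \<in> L1 M"
    and nonneg: "\<And>A. A \<in> sets G \<Longrightarrow> 0 \<le> strong_integral M (\<lambda>w. indicator A w *\<^sub>R h w)"
  shows "AE w in M. 0 \<le> h w"
proof -
  obtain D where D: "countable D" "h ` space M \<subseteq> closure D"
    using strongly_measurable_separable_range[OF L1_strongly_measurable[OF h]] by blast
  let ?r = "\<lambda>n. 1 / real (Suc n)"
  \<comment> \<open>The centre is at least twice the radius away from the cone. An average over
    \<open>A (d, n)\<close> lies within one radius of \<open>d\<close>, so it cannot be
    nonnegative.\<close>
  define S where "S = {(d, n). d \<in> D \<and> (\<forall>x\<ge>0. 2 * ?r n \<le> dist d x)}"
  define A where "A = (\<lambda>(d, n). {w \<in> space M. dist d (h w) < ?r n})"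
  have "countable S"
    by (rule countable_subset[of _ "D \<times> UNIV"]) (use D in \<open>auto simp: S_def\<close>)
  have [measurable]: "h \<in> borel_measurable G" using hG by (rule strongly_measurable_borel)
  have AG: "A p \<in> sets G" for p
  proof -
    have "{w \<in> space G. dist d (h w) < ?r n} = h -` ball d (?r n) \<inter> space G" for d n
      by auto
    then have "{w \<in> space G. dist d (h w) < ?r n} \<in> sets G" for d n
      by (metis measurable_sets[OF \<open>h \<in> borel_measurable G\<close>] borel_open open_ball)
    then show ?thesis
      using sub by (auto simp: A_def subalgebra_def split: prod.splits)
  qed
  then have AM: "A p \<in> sets M" for p using sub unfolding subalgebra_def by blast
  have null: "AE w in M. w \<notin> A p" if "p \<in> S" for p
  proof -
    obtain d n where p: "p = (d, n)" by (cases p)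
    let ?m = "measure M (A p)"
    have "?m = 0"
    proof (rule ccontr)
      assume "?m \<noteq> 0"
      then have m: "0 < ?m" by (simp add: order_less_le)
      let ?y = "strong_integral M (\<lambda>w. indicator (A p) w *\<^sub>R h w)"
      have "?y - ?m *\<^sub>R d = strong_integral M (\<lambda>w. indicator (A p) w *\<^sub>R h w - indicator (A p) w *\<^sub>R d)"
        by (simp add: strong_integral_diff L1_indicator h L1_const AM strong_integral_indicator_const)
      also have "norm \<dots> \<le> (LINT w|M. norm (indicator (A p) w *\<^sub>R h w - indicator (A p) w *\<^sub>R d))"
        by (intro norm_strong_integral_le L1_diff L1_indicator h L1_const AM)
      also have "\<dots> \<le> (LINT w|M. ?r n * indicator (A p) w)"
      proof (intro integral_mono L1_integrable_norm L1_diff L1_indicator h L1_const AM)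
        show "integrable M (\<lambda>w. ?r n * indicat_real (A p) w)"
          using AM by (intro integrable_mult_right integrable_real_indicator) (auto simp: emeasure_eq_measure)
        fix w show "norm (indicat_real (A p) w *\<^sub>R h w - indicat_real (A p) w *\<^sub>R d) \<le> ?r n * indicat_real (A p) w"
          by (auto simp: indicator_def A_def p dist_norm norm_minus_commute)
      qed
      also have "\<dots> = ?r n * ?m" using AM by simp
      finally have "norm (?y - ?m *\<^sub>R d) \<le> ?r n * ?m" .
      moreover have "norm (?y - ?m *\<^sub>R d) = ?m * dist d ((1 / ?m) *\<^sub>R ?y)"
      proof -
        have "?y - ?m *\<^sub>R d = - (?m *\<^sub>R (d - (1 / ?m) *\<^sub>R ?y))"
          using m by (simp add: scaleR_diff_right)
        then show ?thesis using m by (simp only: norm_minus_cancel dist_norm) simp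
      qed
      ultimately have "?m * dist d ((1 / ?m) *\<^sub>R ?y) \<le> ?m * ?r n"
        by (simp only: mult.commute[of "?r n"])
      then have "dist d ((1 / ?m) *\<^sub>R ?y) \<le> ?r n"
        using m by (simp only: mult_le_cancel_left_pos)
      moreover have "0 \<le> (1 / ?m) *\<^sub>R ?y"
        using m by (intro scaleR_nonneg_nonneg nonneg AG) auto
      ultimately have "2 * ?r n \<le> ?r n"
        using that by (fastforce simp: S_def p)
      moreover have "0 < ?r n" by simp
      ultimately show False by linarith
    qed
    then have "A p \<in> null_sets M" using AM by (intro null_setsI) (auto simp: emeasure_eq_measure)
    then show ?thesis by (rule AE_not_in)
  qed
  have "AE w in M. \<forall>p\<in>S. w \<notin> A p"
    using null \<open>countable S\<close> by (simp add: AE_ball_countable)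
  then show ?thesis
    using AE_space
  proof eventually_elim
    case (elim w)
    show "0 \<le> h w"
    proof (rule ccontr)
      assume "\<not> 0 \<le> h w"
      moreover have "open (- {x :: 'b. 0 \<le> x})" by (rule open_Compl[OF closed_nonneg])
      ultimately obtain e where e: "0 < e" "ball (h w) e \<subseteq> - {x. 0 \<le> x}"
        unfolding open_contains_ball by blast
      \<comment> \<open>With \<open>d\<close> within \<open>?r n < e / 3\<close> of
        \<open>h w\<close>, its distance to the cone is still at least
        \<open>e - ?r n > 2 * ?r n\<close>.\<close>
      obtain n where n: "?r n < e / 3" using e(1) nat_approx_posE[of "e / 3"] by auto
      have "h w \<in> closure D" using D(2) elim(2) by auto
      then obtain d where d: "d \<in> D" "dist d (h w) < ?r n"
        unfolding closure_approachable by (metis divide_pos_pos of_nat_0_less_iff zero_less_Suc zero_less_one)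
      have "2 * ?r n \<le> dist d x" if "0 \<le> x" for x
      proof -
        have "e \<le> dist (h w) x" using e(2) that by (auto simp: subset_iff not_less[symmetric])
        then show ?thesis
          using dist_triangle[of "h w" x d] d(2) n by (simp add: dist_commute)
      qed
      then have "(d, n) \<in> S" using d(1) by (auto simp: S_def)
      then show False using elim d(2) by (auto simp: A_def)
    qed
  qed
qed

end

section \<open>Conditional expectations and the maximal inequality\<close>

text \<open>The difference \<open>g' - g\<close> is measurable for \<open>G\<close> and has
  nonnegative integrals over all sets of \<open>G\<close>. Comparing only set integrals of
  \<open>f\<close> and \<open>f'\<close> lets the same lemma, used twice with \<open>f = f'\<close>,
  yield uniqueness.\<close>

lemma (in finite_measure) is_cond_exp_mono:
  fixes f :: "'a \<Rightarrow> 'b::banach_lattice"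
  assumes sub: "subalgebra M G" and f: "f \<in> L1 M" "is_cond_exp M G f g"
    and f': "f' \<in> L1 M" "is_cond_exp M G f' g'"
    and le: "\<And>A. A \<in> sets G \<Longrightarrow> strong_integral M (\<lambda>w. indicator A w *\<^sub>R f w)
                \<le> strong_integral M (\<lambda>w. indicator A w *\<^sub>R f' w)"
  shows "AE w in M. g w \<le> g' w"
proof -
  have g: "strongly_measurable G g" "g \<in> L1 M" and g': "strongly_measurable G g'" "g' \<in> L1 M"
    using f f' by (auto simp: is_cond_exp_def)
  have "AE w in M. 0 \<le> g' w - g w"
  proof (rule AE_nonneg_if_set_integrals_nonneg[OF sub strongly_measurable_diff[OF g'(1) g(1)] L1_diff[OF g'(2) g(2)]])
    fix A assume A: "A \<in> sets G"
    then have AM: "A \<in> sets M" using sub unfolding subalgebra_def by blast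
    have "strong_integral M (\<lambda>w. indicator A w *\<^sub>R (g' w - g w)) =
        strong_integral M (\<lambda>w. indicator A w *\<^sub>R g' w) - strong_integral M (\<lambda>w. indicator A w *\<^sub>R g w)"
      by (simp add: scaleR_diff_right strong_integral_diff L1_indicator g g' AM)
    also have "\<dots> = strong_integral M (\<lambda>w. indicator A w *\<^sub>R f' w) - strong_integral M (\<lambda>w. indicator A w *\<^sub>R f w)"
      using A f(2) f'(2) by (simp add: is_cond_exp_def)
    finally show "0 \<le> strong_integral M (\<lambda>w. indicator A w *\<^sub>R (g' w - g w))"
      using le[OF A] by simp
  qed
  then show ?thesis by simp
qed

lemma (in finite_measure) is_cond_exp_unique:
  fixes f :: "'a \<Rightarrow> 'b::banach_lattice"
  assumes "subalgebra M G" "f \<in> L1 M" "is_cond_exp M G f g" "is_cond_exp M G f g'"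
  shows "AE w in M. g w = g' w"
  using is_cond_exp_mono[OF assms(1,2,3,2,4)] is_cond_exp_mono[OF assms(1,2,4,2,3)]
  by (auto intro: antisym)

section \<open>Calculus of conditional expectations along the filtration\<close>

text \<open>\<open>E n f\<close> is an arbitrary version chosen separately for each
  \<open>f\<close>, so linearity, monotonicity and the tower property hold only almost everywhere,
  with an exceptional set depending on the functions.\<close>

locale filtered_cond_exp = prob_space M for M :: "'w measure" +
  fixes F :: "nat \<Rightarrow> 'w measure"
    and E :: "nat \<Rightarrow> ('w \<Rightarrow> 'f::banach_lattice) \<Rightarrow> 'w \<Rightarrow> 'f"
  assumes filtration: "filtration (space M) F"
    and subalgebra: "\<And>n. subalgebra M (F n)"
    and is_cond_exp: "\<And>n f. f \<in> L1 M \<Longrightarrow> is_cond_exp M (F n) f (E n f)"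
begin

lemma sets_F_subset: "A \<in> sets (F n) \<Longrightarrow> A \<in> sets M"
  using subalgebra[of n] unfolding subalgebra_def by blast

lemma sets_F_mono: "n \<le> m \<Longrightarrow> A \<in> sets (F n) \<Longrightarrow> A \<in> sets (F m)"
  using filtration unfolding filtration_def by blast

lemma E_L1: "f \<in> L1 M \<Longrightarrow> E n f \<in> L1 M"
  using is_cond_exp[of f n] by (simp add: is_cond_exp_def)

lemma E_strongly_measurable: "f \<in> L1 M \<Longrightarrow> strongly_measurable (F n) (E n f)"
  using is_cond_exp[of f n] by (simp add: is_cond_exp_def)

lemma E_set_integral:
  "f \<in> L1 M \<Longrightarrow> A \<in> sets (F n) \<Longrightarrow>
    strong_integral M (\<lambda>w. indicator A w *\<^sub>R E n f w) = strong_integral M (\<lambda>w. indicator A w *\<^sub>R f w)"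
  using is_cond_exp[of f n] by (simp add: is_cond_exp_def)

lemma E_integral:
  assumes "f \<in> L1 M"
  shows "strong_integral M (E n f) = strong_integral M f"
proof -
  have *: "strong_integral M (\<lambda>w. indicator (space M) w *\<^sub>R g w) = strong_integral M g"
    if "g \<in> L1 M" for g :: "'w \<Rightarrow> 'f"
    using AE_space[of M] by (intro strong_integral_cong_AE L1_indicator that) auto
  have "space M \<in> sets (F n)"
    using subalgebra[of n] by (metis sets.top subalgebra_def)
  from E_set_integral[OF assms this] show ?thesis
    by (simp add: * assms E_L1)
qed

lemma E_mono:
  assumes "f \<in> L1 M" "g \<in> L1 M" "AE w in M. f w \<le> g w"
  shows "AE w in M. E n f w \<le> E n g w"
proof (rule is_cond_exp_mono[OF subalgebra assms(1) is_cond_exp[OF assms(1)] assms(2) is_cond_exp[OF assms(2)]])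
  fix A assume "A \<in> sets (F n)"
  then show "strong_integral M (\<lambda>w. indicator A w *\<^sub>R f w) \<le> strong_integral M (\<lambda>w. indicator A w *\<^sub>R g w)"
    using assms
    by (intro strong_integral_mono_AE L1_indicator sets_F_subset) (auto intro: scaleR_left_mono)
qed

lemma E_add:
  assumes f: "f \<in> L1 M" and g: "g \<in> L1 M"
  shows "AE w in M. E n (\<lambda>w. f w + g w) w = E n f w + E n g w"
proof (rule is_cond_exp_unique[OF subalgebra L1_add[OF f g] is_cond_exp[OF L1_add[OF f g]]])
  show "is_cond_exp M (F n) (\<lambda>w. f w + g w) (\<lambda>w. E n f w + E n g w)"
    unfolding is_cond_exp_def using f g
    by (auto simp: strongly_measurable_add E_strongly_measurable L1_add E_L1 scaleR_add_right
        strong_integral_add L1_indicator sets_F_subset E_set_integral)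
qed

lemma E_scaleR:
  assumes f: "f \<in> L1 M"
  shows "AE w in M. E n (\<lambda>w. c *\<^sub>R f w) w = c *\<^sub>R E n f w"
proof (rule is_cond_exp_unique[OF subalgebra L1_scaleR[OF f] is_cond_exp[OF L1_scaleR[OF f]]])
  have "strong_integral M (\<lambda>w. indicator A w *\<^sub>R c *\<^sub>R g w) = c *\<^sub>R strong_integral M (\<lambda>w. indicator A w *\<^sub>R g w)"
    if "g \<in> L1 M" "A \<in> sets M" for g :: "'w \<Rightarrow> 'f" and A
    using strong_integral_scaleR[OF L1_indicator[OF that], of c] by (simp add: mult.commute)
  then show "is_cond_exp M (F n) (\<lambda>w. c *\<^sub>R f w) (\<lambda>w. c *\<^sub>R E n f w)"
    unfolding is_cond_exp_def using f
    by (auto simp: strongly_measurable_scaleR E_strongly_measurable L1_scaleR E_L1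
        sets_F_subset E_set_integral simp del: scaleR_scaleR)
qed

lemma E_diff:
  assumes f: "f \<in> L1 M" and g: "g \<in> L1 M"
  shows "AE w in M. E n (\<lambda>w. f w - g w) w = E n f w - E n g w"
  using E_add[OF f L1_scaleR[OF g, of "-1"], of n] E_scaleR[OF g, of n "-1"] by auto

lemma E_tower:
  assumes f: "f \<in> L1 M" and "n \<le> m"
  shows "AE w in M. E n (E m f) w = E n f w"
proof (rule is_cond_exp_unique[OF subalgebra f _ is_cond_exp[OF f]])
  show "is_cond_exp M (F n) f (E n (E m f))"
    unfolding is_cond_exp_def using f \<open>n \<le> m\<close>
    by (auto simp: E_strongly_measurable E_L1 E_set_integral sets_F_mono)
qed

text \<open>Measurability is required only up to a null set: \<open>F n\<close> is not assumed to
  contain the null sets of \<open>M\<close>, and membership in the range of \<open>E n\<close> is a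
  property of classes.\<close>

definition adapted :: "nat \<Rightarrow> ('w \<Rightarrow> 'f) \<Rightarrow> bool" where
  "adapted n f \<longleftrightarrow> f \<in> L1 M \<and> (\<exists>g. strongly_measurable (F n) g \<and> (AE w in M. f w = g w))"

lemma adapted_L1: "adapted n f \<Longrightarrow> f \<in> L1 M"
  by (simp add: adapted_def)

lemma adapted_E: "f \<in> L1 M \<Longrightarrow> adapted n (E n f)"
  unfolding adapted_def using E_L1 E_strongly_measurable by blast

lemma adapted_cong_AE: "f \<in> L1 M \<Longrightarrow> AE w in M. f w = g w \<Longrightarrow> adapted n g \<Longrightarrow> adapted n f"
  unfolding adapted_def by (elim conjE exE) (auto intro!: exI)

lemma adapted_mono:
  assumes "adapted n f" "n \<le> m"
  shows "adapted m f"
proof -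
  have "space (F n) = space M" for n using subalgebra[of n] by (simp add: subalgebra_def)
  have "subalgebra (F m) (F n)"
    using \<open>\<And>n. space (F n) = space M\<close> sets_F_mono[OF assms(2)] by (auto simp: subalgebra_def)
  then show ?thesis
    using assms(1) strongly_measurable_subalgebra unfolding adapted_def by blast
qed

lemma adapted_compose2:
  assumes "adapted n f" "adapted n g" "continuous_on UNIV (\<lambda>x. p (fst x) (snd x))"
    and "(\<lambda>w. p (f w) (g w)) \<in> L1 M"
  shows "adapted n (\<lambda>w. p (f w) (g w))"
proof -
  obtain f' g' where f': "strongly_measurable (F n) f'" "AE w in M. f w = f' w"
    and g': "strongly_measurable (F n) g'" "AE w in M. g w = g' w"
    using assms(1,2) unfolding adapted_def by blast
  have "AE w in M. p (f w) (g w) = p (f' w) (g' w)" using f'(2) g'(2) by auto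
  with strongly_measurable_compose2[OF f'(1) g'(1) assms(3)] assms(4)
  show ?thesis unfolding adapted_def by (intro conjI exI[of _ "\<lambda>w. p (f' w) (g' w)"])
qed

lemma adapted_const: "adapted n (\<lambda>_. c)"
  unfolding adapted_def using L1_const strongly_measurable_const by blast

lemma adapted_diff: "adapted n f \<Longrightarrow> adapted n g \<Longrightarrow> adapted n (\<lambda>w. f w - g w)"
  by (rule adapted_compose2[where p = "(-)"]) (auto intro!: continuous_intros L1_diff dest: adapted_L1)

lemma adapted_scaleR: "adapted n f \<Longrightarrow> adapted n (\<lambda>w. c *\<^sub>R f w)"
  by (rule adapted_compose2[where g = f and p = "\<lambda>x _. c *\<^sub>R x"])
     (auto intro!: continuous_intros L1_scaleR dest: adapted_L1)

lemma adapted_pprt: "adapted n f \<Longrightarrow> adapted n (\<lambda>w. pprt (f w))"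
  by (rule adapted_compose2[where g = f and p = "\<lambda>x _. pprt x"])
     (auto intro!: continuous_intros L1_pprt dest: adapted_L1)

lemma adapted_inf: "adapted n f \<Longrightarrow> adapted n g \<Longrightarrow> adapted n (\<lambda>w. inf (f w) (g w))"
  by (rule adapted_compose2[where p = "inf"]) (auto intro!: continuous_intros L1_inf dest: adapted_L1)

lemma E_adapted:
  assumes "adapted n f"
  shows "AE w in M. E n f w = f w"
proof -
  obtain g where g: "strongly_measurable (F n) g" and eq: "AE w in M. f w = g w" and f: "f \<in> L1 M"
    using assms unfolding adapted_def by blast
  have gL: "g \<in> L1 M"
    by (rule L1_bound[OF f strongly_measurable_subalgebra[OF g subalgebra]]) (use eq in auto)
  have "is_cond_exp M (F n) f g"
    unfolding is_cond_exp_def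
  proof (intro conjI ballI g gL)
    fix A assume "A \<in> sets (F n)"
    then show "strong_integral M (\<lambda>w. indicator A w *\<^sub>R g w) = strong_integral M (\<lambda>w. indicator A w *\<^sub>R f w)"
      using eq by (intro strong_integral_cong_AE L1_indicator f gL sets_F_subset) auto
  qed
  from is_cond_exp_unique[OF subalgebra f is_cond_exp[OF f] this] show ?thesis
    using eq by auto
qed

lemma E_const: "AE w in M. E n (\<lambda>_. c) w = c"
  by (rule E_adapted[OF adapted_const])

end

text \<open>The supremum of the \<open>k + 1\<close> values from index \<open>n\<close> to
  \<open>n + k\<close>. The recursion splits off the lowest index, to match the backward induction
  of the maximal inequality.\<close>

primrec running_sup :: "(nat \<Rightarrow> 'a::semilattice_sup) \<Rightarrow> nat \<Rightarrow> nat \<Rightarrow> 'a" where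
  "running_sup f n 0 = f n"
| "running_sup f n (Suc k) = sup (f n) (running_sup f (Suc n) k)"

lemma running_sup_upper: "n \<le> i \<Longrightarrow> i \<le> n + k \<Longrightarrow> f i \<le> running_sup f n k"
proof (induction k arbitrary: n)
  case (Suc k)
  then show ?case by (cases "i = n") (auto intro: le_supI2)
qed simp

lemma running_sup_least:
  "(\<And>i. n \<le> i \<Longrightarrow> i \<le> n + k \<Longrightarrow> f i \<le> u) \<Longrightarrow> running_sup f n k \<le> u"
  by (induction k arbitrary: n) auto

lemma incseq_running_sup: "incseq (running_sup f n)"
  unfolding incseq_def
  by (auto intro!: running_sup_least running_sup_upper)

lemma (in finite_measure) L1_running_sup:
  fixes f :: "nat \<Rightarrow> 'a \<Rightarrow> 'b::banach_lattice"
  assumes "\<And>i. f i \<in> L1 M"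
  shows "(\<lambda>w. running_sup (\<lambda>i. f i w) n k) \<in> L1 M"
  using assms by (induction k arbitrary: n) (auto intro: L1_sup)

context filtered_cond_exp
begin

text \<open>
  The truncation \<open>inf (pprt (c *\<^sub>R (q - u))) u\<close> stands for the indicator of \<open>q > u\<close>. It vanishes where
  \<open>q\<close> is below \<open>u\<close>, so adding it to \<open>q\<close> and truncating at \<open>u\<close> again does not exceed \<open>q\<close>
  (\<open>add_pprt_inf_le\<close>); this lets a backward induction do without stopping times.
\<close>

lemma maximal_inequality:
  assumes u: "0 \<le> u" and c: "0 \<le> c"
    and qL: "\<And>i. q i \<in> L1 M"
    and adapted: "\<And>i. n \<le> i \<Longrightarrow> i \<le> n + k \<Longrightarrow> adapted i (q i)"
    and nonneg: "\<And>i. n \<le> i \<Longrightarrow> i \<le> n + k \<Longrightarrow> AE w in M. 0 \<le> q i w"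
    and super: "\<And>i. n \<le> i \<Longrightarrow> i < n + k \<Longrightarrow> AE w in M. E i (q (Suc i)) w \<le> q i w"
  shows "AE w in M. E n (\<lambda>w. running_sup (\<lambda>i. inf (pprt (c *\<^sub>R (q i w - u))) u) n k) w \<le> q n w"
  using adapted nonneg super
proof (induction k arbitrary: n)
  case 0
  let ?a = "\<lambda>w. inf (pprt (c *\<^sub>R (q n w - u))) u"
  have "adapted n ?a"
    using 0(1)[of n] by (intro adapted_inf adapted_pprt adapted_scaleR adapted_diff adapted_const) auto
  then have "AE w in M. E n ?a w = ?a w" by (rule E_adapted)
  moreover have "AE w in M. 0 \<le> q n w" using 0(2)[of n] by simp
  ultimately have "AE w in M. E n ?a w \<le> q n w"
  proof eventually_elim
    case (elim w)
    have "?a w \<le> inf (?a w + q n w) u"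
      by (rule inf_greatest) (use elim in \<open>simp_all only: le_add_same_cancel1 inf_le2\<close>)
    also have "\<dots> \<le> q n w" by (rule add_pprt_inf_le[OF elim(2) u c])
    finally show ?case using elim(1) by (simp only:)
  qed
  then show ?case by (simp only: running_sup.simps)
next
  case (Suc k)
  let ?a = "\<lambda>i w. inf (pprt (c *\<^sub>R (q i w - u))) u"
  let ?P = "\<lambda>w. running_sup (\<lambda>i. ?a i w) (Suc n) k"
  have aL: "?a i \<in> L1 M" for i
    by (intro L1_inf L1_pprt L1_scaleR L1_diff L1_const qL)
  have PL: "?P \<in> L1 M" by (rule L1_running_sup[OF aL])
  have a_nonneg: "0 \<le> ?a i w" for i w using u by simp
  have P_nonneg: "0 \<le> ?P w" for w
    by (rule order_trans[OF a_nonneg running_sup_upper[of "Suc n" "Suc n" k "\<lambda>i. ?a i w"]]) simp_all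
  let ?S = "\<lambda>w. sup (?a n w) (?P w)"
  have SL: "?S \<in> L1 M" by (intro L1_sup aL PL)
  have "adapted n (?a n)"
    using Suc.prems(1)[of n]
    by (intro adapted_inf adapted_pprt adapted_scaleR adapted_diff adapted_const) auto
  then have 1: "AE w in M. E n (?a n) w = ?a n w" by (rule E_adapted)
  have "AE w in M. E (Suc n) ?P w \<le> q (Suc n) w"
    using Suc.prems by (intro Suc.IH) auto
  then have "AE w in M. E n (E (Suc n) ?P) w \<le> E n (q (Suc n)) w"
    by (intro E_mono E_L1 PL qL)
  moreover have "AE w in M. E n (q (Suc n)) w \<le> q n w" using Suc.prems(3)[of n] by simp
  moreover have "AE w in M. E n (E (Suc n) ?P) w = E n ?P w" by (rule E_tower[OF PL]) simp
  ultimately have 2: "AE w in M. E n ?P w \<le> q n w" by eventually_elim simp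
  \<comment> \<open>A supremum of nonnegative terms is estimated by their sum, which is compatible
    with \<open>E n\<close>. The loss is repaired by combining this with the bound \<open>u\<close>
    from \<open>5\<close>.\<close>
  have 3: "AE w in M. E n ?S w \<le> E n (\<lambda>w. ?a n w + ?P w) w"
    by (intro E_mono SL L1_add aL PL) (use a_nonneg P_nonneg in \<open>auto simp: le_supI add_increasing add_increasing2\<close>)
  have 4: "AE w in M. E n (\<lambda>w. ?a n w + ?P w) w = E n (?a n) w + E n ?P w"
    by (rule E_add[OF aL PL])
  have "?S w \<le> u" for w
    using running_sup_least[of "Suc n" k "\<lambda>i. ?a i w" u] by simp
  then have 5: "AE w in M. E n ?S w \<le> E n (\<lambda>_. u) w"
    by (intro E_mono SL L1_const) auto
  have 6: "AE w in M. 0 \<le> q n w" using Suc.prems(2)[of n] by simp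
  from 1 2 3 4 5 E_const[of n u] 6 have "AE w in M. E n ?S w \<le> q n w"
  proof eventually_elim
    case (elim w)
    have "E n ?S w \<le> inf (?a n w + q n w) u"
    proof (rule inf_greatest)
      have "E n ?S w \<le> ?a n w + E n ?P w" using elim by simp
      also have "\<dots> \<le> ?a n w + q n w" using elim by (intro add_left_mono)
      finally show "E n ?S w \<le> ?a n w + q n w" .
      show "E n ?S w \<le> u" using elim by simp
    qed
    also have "\<dots> \<le> q n w" by (rule add_pprt_inf_le[OF elim(7) u c])
    finally show ?case .
  qed
  then show ?case by simp
qed

end

section \<open>Oscillation of submartingales\<close>

locale lattice_submartingale = filtered_cond_exp M F E
  for M :: "'a measure" and F :: "nat \<Rightarrow> 'a measure"
    and E :: "nat \<Rightarrow> ('a \<Rightarrow> 'b::banach_lattice) \<Rightarrow> 'a \<Rightarrow> 'b" +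
  fixes z :: "nat \<Rightarrow> 'a \<Rightarrow> 'b" and x0 :: 'b and C :: real
  assumes order_continuous: "order_continuous TYPE('b)"
    and weak_unit: "weak_unit x0"
    and adapted_z: "\<And>n. adapted n (z n)"
    and le_E_z: "\<And>n m. n \<le> m \<Longrightarrow> AE w in M. z n w \<le> E n (z m) w"
    and norm_z_le: "\<And>n. (LINT w|M. norm (z n w)) \<le> C"
begin

lemma x0_nonneg: "0 \<le> x0"
  using weak_unit by (simp add: weak_unit_def less_imp_le)

lemma z_L1: "z n \<in> L1 M"
  by (rule adapted_L1[OF adapted_z])

definition increment :: "nat \<Rightarrow> nat \<Rightarrow> 'a \<Rightarrow> 'b" where
  "increment N m = (\<lambda>w. pprt (z m w - z N w))"

definition oscillation :: "nat \<Rightarrow> nat \<Rightarrow> 'a \<Rightarrow> 'b" where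
  "oscillation N k w = running_sup (\<lambda>i. inf \<bar>z i w - z N w\<bar> x0) N k"

lemma increment_L1: "increment N m \<in> L1 M"
  unfolding increment_def by (intro L1_pprt L1_diff z_L1)

lemma oscillation_L1: "oscillation N k \<in> L1 M"
  unfolding oscillation_def by (intro L1_running_sup L1_inf L1_abs L1_diff z_L1 L1_const)

lemma E_nonneg:
  assumes "f \<in> L1 M" "\<And>w. 0 \<le> f w"
  shows "AE w in M. 0 \<le> E n f w"
  using E_mono[OF L1_const assms(1), of 0 n] E_const[of n 0] assms(2) by auto

text \<open>\<open>E i (z m)\<close> dominates \<open>z i\<close>, and \<open>z N\<close> passes
  through \<open>E i\<close> because \<open>N \<le> i\<close>. For fixed \<open>m\<close>, the
  process \<open>E i (increment N m)\<close> is thus a martingale that majorizes both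
  \<open>z i - z N\<close> and \<open>0\<close>.\<close>

lemma increment_le_E:
  assumes "N \<le> i" "i \<le> m"
  shows "AE w in M. z i w - z N w \<le> E i (increment N m) w"
proof -
  have 1: "AE w in M. E i (\<lambda>w. z m w - z N w) w \<le> E i (increment N m) w"
    by (intro E_mono increment_L1 L1_diff z_L1) (simp add: increment_def le_pprt)
  have 2: "AE w in M. E i (\<lambda>w. z m w - z N w) w = E i (z m) w - E i (z N) w"
    by (intro E_diff z_L1)
  have 3: "AE w in M. E i (z N) w = z N w"
    by (intro E_adapted adapted_mono[OF adapted_z] assms)
  from 1 2 3 le_E_z[OF assms(2)] show ?thesis
  proof eventually_elim
    case (elim w)
    have "z i w - z N w \<le> E i (z m) w - z N w" using elim by simp
    also have "\<dots> \<le> E i (increment N m) w" using elim(1) by (simp only: elim(2,3))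
    finally show ?case .
  qed
qed

text \<open>
  \<open>q i\<close> is a positive supermartingale that dominates \<open>\<bar>z i - z N\<bar> / t\<close> in both directions at once and
  starts at \<open>2 E N (increment N m) / t\<close>.
\<close>

lemma oscillation_integral_le:
  assumes "0 < t" "t \<le> 2"
  shows "strong_integral M (oscillation N k) \<le> t *\<^sub>R x0 +
    (2 / t) *\<^sub>R strong_integral M (\<lambda>w. inf (E N (increment N (N + k)) w) x0)"
proof -
  let ?G = "increment N (N + k)"
  define q where "q i w = (1 / t) *\<^sub>R (2 *\<^sub>R E i ?G w - (z i w - z N w))" for i w
  let ?psi = "\<lambda>i w. inf (pprt (t *\<^sub>R (q i w - x0))) x0"
  let ?R = "\<lambda>w. running_sup (\<lambda>i. ?psi i w) N k"
  have qL: "q i \<in> L1 M" for i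
    unfolding q_def by (intro L1_scaleR L1_diff E_L1 increment_L1 z_L1)
  have psiL: "?psi i \<in> L1 M" for i
    by (intro L1_inf L1_pprt L1_scaleR L1_diff L1_const qL)
  have RL: "?R \<in> L1 M" by (rule L1_running_sup[OF psiL])
  have G_nonneg: "AE w in M. 0 \<le> E i ?G w" for i
    by (rule E_nonneg[OF increment_L1]) (simp add: increment_def)
  have q_bound: "AE w in M. 0 \<le> q i w \<and> \<bar>z i w - z N w\<bar> \<le> t *\<^sub>R q i w"
    if "N \<le> i" "i \<le> N + k" for i
    using increment_le_E[OF that] G_nonneg[of i]
  proof eventually_elim
    case (elim w)
    let ?e = "E i ?G w" and ?y = "z i w - z N w"
    have lq: "t *\<^sub>R q i w = ?e + ?e - ?y" using assms by (simp add: q_def scaleR_2)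
    \<comment> \<open>With \<open>?e \<ge> ?y\<close> and \<open>?e \<ge> 0\<close>, the vector
      \<open>2 *\<^sub>R ?e - ?y\<close> is above both \<open>?y\<close> and \<open>- ?y\<close>.
      This is the origin of the coefficient \<open>2\<close> in \<open>q\<close>.\<close>
    have "?y \<le> ?e + ?e - ?y" using add_mono[OF elim(1,1)] by (simp only: le_diff_eq)
    moreover have "- ?y \<le> ?e + ?e - ?y" using add_mono[OF elim(2,2)] by simp
    ultimately have abs: "\<bar>?y\<bar> \<le> t *\<^sub>R q i w" unfolding lq by (rule abs_leI)
    then have "0 \<le> t *\<^sub>R q i w" using abs_ge_zero order_trans by blast
    then have "0 \<le> (1 / t) *\<^sub>R (t *\<^sub>R q i w)"
      using assms by (intro scaleR_nonneg_nonneg[of "1 / t" "t *\<^sub>R q i w"]) simp_all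
    then show ?case using abs assms by simp
  qed
  have "AE w in M. E N ?R w \<le> q N w"
  proof (rule maximal_inequality[OF x0_nonneg _ qL])
    fix i assume i: "N \<le> i" "i \<le> N + k"
    show "adapted i (q i)"
      unfolding q_def
      by (intro adapted_scaleR adapted_diff adapted_E increment_L1 adapted_z adapted_mono[OF adapted_z i(1)])
    show "AE w in M. 0 \<le> q i w" using q_bound[OF i] by auto
  next
    fix i assume i: "N \<le> i" "i < N + k"
    let ?y = "\<lambda>w. z (Suc i) w - z N w"
    \<comment> \<open>Up to the factor \<open>1 / t\<close>, \<open>q\<close> is a martingale minus
      a submartingale, hence a supermartingale.\<close>
    have 1: "AE w in M. E i (q (Suc i)) w = (1 / t) *\<^sub>R E i (\<lambda>w. 2 *\<^sub>R E (Suc i) ?G w - ?y w) w"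
      unfolding q_def by (intro E_scaleR L1_diff L1_scaleR E_L1 increment_L1 z_L1)
    have 2: "AE w in M. E i (\<lambda>w. 2 *\<^sub>R E (Suc i) ?G w - ?y w) w = E i (\<lambda>w. 2 *\<^sub>R E (Suc i) ?G w) w - E i ?y w"
      by (intro E_diff L1_diff L1_scaleR E_L1 increment_L1 z_L1)
    have 3: "AE w in M. E i (\<lambda>w. 2 *\<^sub>R E (Suc i) ?G w) w = 2 *\<^sub>R E i (E (Suc i) ?G) w"
      by (intro E_scaleR E_L1 increment_L1)
    have 4: "AE w in M. E i (E (Suc i) ?G) w = E i ?G w"
      by (intro E_tower increment_L1) simp
    have 5: "AE w in M. E i ?y w = E i (z (Suc i)) w - E i (z N) w"
      by (intro E_diff z_L1)
    have 6: "AE w in M. E i (z N) w = z N w"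
      by (intro E_adapted adapted_mono[OF adapted_z] i)
    have 7: "AE w in M. z i w \<le> E i (z (Suc i)) w"
      by (rule le_E_z) simp
    from 1 2 3 4 5 6 7 show "AE w in M. E i (q (Suc i)) w \<le> q i w"
    proof eventually_elim
      case (elim w)
      have "2 *\<^sub>R E i ?G w - (E i (z (Suc i)) w - z N w) \<le> 2 *\<^sub>R E i ?G w - (z i w - z N w)"
        using elim(7) by (intro diff_left_mono diff_right_mono)
      then show ?case
        unfolding q_def elim(1)[unfolded q_def] elim(2-6)
        using assms by (intro scaleR_left_mono) auto
    qed
  qed (use assms in auto)
  moreover have "AE w in M. E N ?R w \<le> E N (\<lambda>_. x0) w"
    by (intro E_mono RL L1_const always_eventually allI running_sup_least) simp
  ultimately have ER: "AE w in M. E N ?R w \<le> (2 / t) *\<^sub>R inf (E N ?G w) x0"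
    using E_const[of N x0]
  proof eventually_elim
    case (elim w)
    have "E N ?R w \<le> inf ((2 / t) *\<^sub>R E N ?G w) x0"
      using elim by (simp add: q_def)
    \<comment> \<open>The assumption \<open>t \<le> 2\<close> serves to make the factor
      \<open>2 / t\<close> at least \<open>1\<close>, so that it can be moved out of the
      truncation.\<close>
    also have "\<dots> \<le> (2 / t) *\<^sub>R inf (E N ?G w) x0"
      using assms x0_nonneg by (intro inf_scaleR_le) auto
    finally show ?case .
  qed
  have "AE w in M. \<forall>i. N \<le> i \<and> i \<le> N + k \<longrightarrow> \<bar>z i w - z N w\<bar> \<le> t *\<^sub>R q i w"
    unfolding AE_all_countable using q_bound by auto
  then have le: "AE w in M. oscillation N k w \<le> t *\<^sub>R x0 + ?R w"
  proof eventually_elim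
    case (elim w)
    show ?case
      unfolding oscillation_def
    proof (rule running_sup_least)
      fix i assume i: "N \<le> i" "i \<le> N + k"
      \<comment> \<open>This splitting dictates the choice \<open>c = t\<close> in the maximal
        inequality: the part of \<open>t *\<^sub>R q i w\<close> above
        \<open>t *\<^sub>R x0\<close>, truncated at \<open>x0\<close>, is
        \<open>?psi i w\<close>.\<close>
      have "\<bar>z i w - z N w\<bar> \<le> t *\<^sub>R x0 + t *\<^sub>R (q i w - x0)"
        using elim i by (simp add: scaleR_diff_right)
      also have "\<dots> \<le> t *\<^sub>R x0 + pprt (t *\<^sub>R (q i w - x0))"
        by (intro add_left_mono le_pprt)
      finally have "inf \<bar>z i w - z N w\<bar> x0 \<le> inf (t *\<^sub>R x0 + pprt (t *\<^sub>R (q i w - x0))) x0"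
        by (meson inf_mono order_refl)
      also have "\<dots> \<le> t *\<^sub>R x0 + ?psi i w"
        using assms x0_nonneg by (intro add_inf_le_of_nonneg scaleR_nonneg_nonneg) auto
      also have "\<dots> \<le> t *\<^sub>R x0 + ?R w"
        by (intro add_left_mono running_sup_upper i)
      finally show "inf \<bar>z i w - z N w\<bar> x0 \<le> t *\<^sub>R x0 + ?R w" .
    qed
  qed
  have infL: "(\<lambda>w. inf (E N ?G w) x0) \<in> L1 M" by (intro L1_inf E_L1 increment_L1 L1_const)
  have "strong_integral M (oscillation N k) \<le> strong_integral M (\<lambda>w. t *\<^sub>R x0 + ?R w)"
    by (rule strong_integral_mono_AE[OF oscillation_L1 L1_add[OF L1_const RL] le])
  also have "\<dots> = t *\<^sub>R x0 + strong_integral M (E N ?R)"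
    by (simp add: strong_integral_add L1_const RL strong_integral_const prob_space E_integral)
  also have "\<dots> \<le> t *\<^sub>R x0 + strong_integral M (\<lambda>w. (2 / t) *\<^sub>R inf (E N ?G w) x0)"
    by (intro add_left_mono strong_integral_mono_AE E_L1 RL L1_scaleR infL ER)
  finally show ?thesis by (simp only: strong_integral_scaleR[OF infL])
qed

section \<open>The submartingales of positive parts above a level\<close>

definition excess :: "real \<Rightarrow> nat \<Rightarrow> 'a \<Rightarrow> 'b" where
  "excess a n = (\<lambda>w. pprt (z n w - a *\<^sub>R x0))"

lemma excess_L1: "excess a n \<in> L1 M"
  unfolding excess_def by (intro L1_pprt L1_diff z_L1 L1_const)

text \<open>Jensen's inequality for \<open>pprt\<close>: it is the least common majorant of the
  identity and \<open>0\<close>, and \<open>E n\<close> respects both comparisons.\<close>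

lemma excess_le_E:
  assumes "n \<le> m"
  shows "AE w in M. excess a n w \<le> E n (excess a m) w"
proof -
  have 1: "AE w in M. E n (\<lambda>w. z m w - a *\<^sub>R x0) w \<le> E n (excess a m) w"
    by (intro E_mono excess_L1 L1_diff z_L1 L1_const) (simp add: excess_def le_pprt)
  have 2: "AE w in M. E n (\<lambda>w. z m w - a *\<^sub>R x0) w = E n (z m) w - E n (\<lambda>_. a *\<^sub>R x0) w"
    by (intro E_diff z_L1 L1_const)
  have 3: "AE w in M. 0 \<le> E n (excess a m) w"
    by (rule E_nonneg[OF excess_L1]) (simp add: excess_def)
  from 1 2 3 le_E_z[OF assms] E_const[of n "a *\<^sub>R x0"] show ?thesis
  proof eventually_elim
    case (elim w)
    have "z n w - a *\<^sub>R x0 \<le> E n (z m) w - a *\<^sub>R x0" using elim by simp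
    also have "\<dots> \<le> E n (excess a m) w" using elim(1) by (simp only: elim(2,5))
    finally show ?case unfolding excess_def[of a n] pprt_le_iff using elim(3) by blast
  qed
qed

text \<open>For any level, \<open>pprt (z m - z n)\<close> is at most
  \<open>pprt (z m - a *\<^sub>R x0) + pprt (a *\<^sub>R x0 - z n)\<close>, and the second term
  passes through \<open>E n\<close>. Adding and subtracting \<open>excess a n\<close> completes it
  to the absolute value.\<close>

lemma increment_le_excess:
  "AE w in M. E n (increment n m) w \<le> (E n (excess a m) w - excess a n w) + \<bar>z n w - a *\<^sub>R x0\<bar>"
proof -
  let ?d = "\<lambda>w. pprt (a *\<^sub>R x0 - z n w)"
  have dL: "?d \<in> L1 M" by (intro L1_pprt L1_diff z_L1 L1_const)
  have 1: "AE w in M. E n (increment n m) w \<le> E n (\<lambda>w. excess a m w + ?d w) w"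
    by (intro E_mono increment_L1 L1_add excess_L1 dL)
       (simp add: increment_def excess_def pprt_diff_triangle)
  have 2: "AE w in M. E n (\<lambda>w. excess a m w + ?d w) w = E n (excess a m) w + E n ?d w"
    by (intro E_add excess_L1 dL)
  have 3: "AE w in M. E n ?d w = ?d w"
    by (intro E_adapted adapted_pprt adapted_diff adapted_z adapted_const)
  from 1 2 3 show ?thesis
    by eventually_elim (simp add: abs_eq_pprt excess_def)
qed

lemma incseq_excess_integral: "incseq (\<lambda>n. strong_integral M (excess a n))"
  unfolding incseq_def
proof (intro allI impI)
  fix n m :: nat assume "n \<le> m"
  from strong_integral_mono_AE[OF excess_L1 E_L1[OF excess_L1] excess_le_E[OF this]]
  show "strong_integral M (excess a n) \<le> strong_integral M (excess a m)"
    by (simp add: E_integral excess_L1)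
qed

lemma norm_integral_abs_z_le: "norm (strong_integral M (\<lambda>w. \<bar>z n w\<bar>)) \<le> C"
  using order_trans[OF norm_strong_integral_le[OF L1_abs[OF z_L1]] , of n C] norm_z_le[of n] by simp

lemma norm_excess_integral_le: "norm (strong_integral M (excess a n)) \<le> C + \<bar>a\<bar> * norm x0"
proof -
  have "norm (strong_integral M (excess a n)) \<le> (LINT w|M. norm (excess a n w))"
    by (rule norm_strong_integral_le[OF excess_L1])
  also have "\<dots> \<le> (LINT w|M. norm (z n w) + \<bar>a\<bar> * norm x0)"
  proof (intro integral_mono L1_integrable_norm excess_L1 Bochner_Integration.integrable_add z_L1)
    fix w show "norm (excess a n w) \<le> norm (z n w) + \<bar>a\<bar> * norm x0"
      using order_trans[OF norm_pprt_le norm_triangle_ineq4, of "z n w" "a *\<^sub>R x0"]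
      by (simp add: excess_def)
  qed simp
  also have "\<dots> = (LINT w|M. norm (z n w)) + \<bar>a\<bar> * norm x0"
    using L1_integrable_norm[OF z_L1, of n] by (simp add: prob_space)
  finally show ?thesis using norm_z_le[of n] by simp
qed

text \<open>\<open>N\<close> depends on the level \<open>a\<close>, so only finitely many levels can
  share one index.\<close>

lemma truncated_excess_increment_small:
  assumes "0 < \<epsilon>"
  shows "\<exists>N. \<forall>n\<ge>N. \<forall>m\<ge>n.
    norm (inf (strong_integral M (excess a m) - strong_integral M (excess a n)) x0) \<le> \<epsilon>"
proof (rule norm_bounded_incseq_truncated_Cauchy[OF order_continuous incseq_excess_integral _
      norm_excess_integral_le x0_nonneg assms])
  show "0 \<le> strong_integral M (excess a n)" for n
    by (rule strong_integral_nonneg_AE[OF excess_L1]) (simp add: excess_def)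
qed

text \<open>
  Where \<open>z n\<close> lies within \<open>\<eta>\<close> of a grid point \<open>a\<close>, the conditional expectation of the increment is at
  most \<open>\<eta>\<close> plus the increment of the convex function \<open>pprt (x - a *\<^sub>R x0)\<close> of the process; beyond the grid the
  truncation at \<open>x0\<close> is controlled by the norm bound.
\<close>

lemma truncated_increment_integral_le:
  assumes "n \<le> m" "0 < r" "0 \<le> \<eta>" "2 * r \<le> real l * \<eta>"
  shows "strong_integral M (\<lambda>w. inf (E n (increment n m) w) x0) \<le>
    (\<Sum>j\<le>l. inf (strong_integral M (excess (- r + real j * \<eta>) m)
              - strong_integral M (excess (- r + real j * \<eta>) n)) x0)
    + \<eta> *\<^sub>R x0 + (2 / r) *\<^sub>R strong_integral M (\<lambda>w. \<bar>z n w\<bar>)"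
proof -
  let ?a = "\<lambda>j. - r + real j * \<eta>"
  let ?gap = "\<lambda>j w. E n (excess (?a j) m) w - excess (?a j) n w"
  let ?B = "\<lambda>w. (\<Sum>j\<le>l. inf (?gap j w) x0) + \<eta> *\<^sub>R x0 + (2 / r) *\<^sub>R \<bar>z n w\<bar>"
  have gapL: "?gap j \<in> L1 M" for j by (intro L1_diff E_L1 excess_L1)
  have infL: "(\<lambda>w. inf (?gap j w) x0) \<in> L1 M" for j by (intro L1_inf gapL L1_const)
  have absL: "(\<lambda>w. \<bar>z n w\<bar>) \<in> L1 M" by (intro L1_abs z_L1)
  have 1: "AE w in M. \<forall>j. E n (increment n m) w \<le> ?gap j w + \<bar>z n w - ?a j *\<^sub>R x0\<bar>"
    unfolding AE_all_countable using increment_le_excess by blast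
  have 2: "AE w in M. \<forall>j. 0 \<le> ?gap j w"
    unfolding AE_all_countable using excess_le_E[OF assms(1)] by (simp only: diff_ge_0_iff_ge) blast
  from 1 2 have le: "AE w in M. inf (E n (increment n m) w) x0 \<le> ?B w"
  proof eventually_elim
    case (elim w)
    let ?g = "E n (increment n m) w" and ?x = "z n w"
    let ?S = "\<Sum>j\<le>l. ?gap j w" and ?P = "pprt (\<bar>?x\<bar> - r *\<^sub>R x0)"
    have gap: "0 \<le> ?gap j w" for j using elim(2) by blast
    have S: "0 \<le> ?S" by (rule sum_nonneg) (rule gap)
    \<comment> \<open>The grid lemma needs one \<open>d\<close> for all grid points. The sum of the
      nonnegative gaps serves as \<open>d\<close>; unlike their supremum it commutes with the
      integral.\<close>
    have "?g \<le> ?S + \<bar>?x - ?a j *\<^sub>R x0\<bar>" if "j \<le> l" for j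
    proof -
      have "(\<Sum>i\<in>{j}. ?gap i w) \<le> ?S" by (rule sum_mono2) (use that gap in \<open>simp_all only: finite_atMost, auto\<close>)
      then have "?gap j w \<le> ?S" by (simp only: sum.insert sum.empty finite.emptyI empty_iff not_False_eq_True add_0_right)
      then show ?thesis using elim(1) by (meson add_right_mono order_trans)
    qed
    from le_grid_bound[OF x0_nonneg assms(3) this]
    have "?g \<le> ?S + \<eta> *\<^sub>R x0 + pprt (- r *\<^sub>R x0 - ?x) + pprt (?x - ?a l *\<^sub>R x0)"
      by simp
    \<comment> \<open>The grid runs from \<open>- r\<close> to at least \<open>r\<close>, so both
      overshoots are at most the part of \<open>\<bar>?x\<bar>\<close> above
      \<open>r *\<^sub>R x0\<close>. The two copies of \<open>?P\<close> account for the final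
      factor \<open>2 / r\<close>.\<close>
    also have "\<dots> \<le> ?S + \<eta> *\<^sub>R x0 + ?P + ?P"
    proof (intro add_mono order_refl pprt_mono)
      show "- r *\<^sub>R x0 - ?x \<le> \<bar>?x\<bar> - r *\<^sub>R x0"
        using abs_ge_minus_self[of ?x] by simp
      have "r *\<^sub>R x0 \<le> ?a l *\<^sub>R x0" using assms(4) x0_nonneg by (intro scaleR_right_mono) auto
      then show "?x - ?a l *\<^sub>R x0 \<le> \<bar>?x\<bar> - r *\<^sub>R x0" by (intro diff_mono abs_ge_self)
    qed
    finally have "inf ?g x0 \<le> inf (?S + \<eta> *\<^sub>R x0 + ?P + ?P) x0" by (meson inf_mono order_refl)
    also have "\<dots> \<le> inf ?S x0 + inf (\<eta> *\<^sub>R x0) x0 + inf ?P x0 + inf ?P x0"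
    proof -
      have e: "0 \<le> \<eta> *\<^sub>R x0" using assms x0_nonneg by (intro scaleR_nonneg_nonneg)
      have "inf (?S + \<eta> *\<^sub>R x0 + ?P + ?P) x0 \<le> inf (?S + \<eta> *\<^sub>R x0 + ?P) x0 + inf ?P x0"
        by (intro inf_add_le x0_nonneg add_nonneg_nonneg S e) simp_all
      also have "\<dots> \<le> (inf (?S + \<eta> *\<^sub>R x0) x0 + inf ?P x0) + inf ?P x0"
        by (intro add_right_mono inf_add_le x0_nonneg add_nonneg_nonneg S e) simp_all
      also have "\<dots> \<le> ((inf ?S x0 + inf (\<eta> *\<^sub>R x0) x0) + inf ?P x0) + inf ?P x0"
        by (intro add_right_mono inf_add_le x0_nonneg S e)
      finally show ?thesis .
    qed
    also have "\<dots> \<le> (\<Sum>j\<le>l. inf (?gap j w) x0) + \<eta> *\<^sub>R x0 + (1 / r) *\<^sub>R \<bar>?x\<bar> + (1 / r) *\<^sub>R \<bar>?x\<bar>"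
      by (intro add_mono pprt_diff_scaleR_inf_le inf_sum_le inf_le1 x0_nonneg gap abs_ge_zero assms)
         simp_all
    also have "\<dots> = ?B w"
      by (simp add: add.assoc scaleR_add_left[symmetric])
    finally show ?case .
  qed
  have BL: "(\<lambda>w. (\<Sum>j\<le>l. inf (?gap j w) x0) + \<eta> *\<^sub>R x0) \<in> L1 M"
    by (intro L1_add L1_sum infL L1_const)
  have "strong_integral M (\<lambda>w. inf (E n (increment n m) w) x0) \<le> strong_integral M ?B"
    by (intro strong_integral_mono_AE le L1_inf E_L1 increment_L1 L1_const L1_add BL L1_scaleR absL)
  also have "\<dots> = (\<Sum>j\<le>l. strong_integral M (\<lambda>w. inf (?gap j w) x0)) + \<eta> *\<^sub>R x0
      + (2 / r) *\<^sub>R strong_integral M (\<lambda>w. \<bar>z n w\<bar>)"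
    by (simp only: strong_integral_add[OF BL L1_scaleR[OF absL]] strong_integral_scaleR[OF absL]
        strong_integral_add[OF L1_sum[OF infL] L1_const] strong_integral_sum[OF infL]
        strong_integral_const prob_space scaleR_one)
  \<comment> \<open>The truncation moves from inside the integral to outside. This is essential,
    because only the truncated increments of the integrals are known to be small.\<close>
  also have "\<dots> \<le> (\<Sum>j\<le>l. inf (strong_integral M (excess (?a j) m) - strong_integral M (excess (?a j) n)) x0)
      + \<eta> *\<^sub>R x0 + (2 / r) *\<^sub>R strong_integral M (\<lambda>w. \<bar>z n w\<bar>)"
  proof (intro add_right_mono sum_mono)
    fix j
    have "strong_integral M (\<lambda>w. inf (?gap j w) x0) \<le> inf (strong_integral M (?gap j)) (strong_integral M (\<lambda>_. x0))"
      by (rule strong_integral_inf_le[OF gapL L1_const])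
    then show "strong_integral M (\<lambda>w. inf (?gap j w) x0)
        \<le> inf (strong_integral M (excess (?a j) m) - strong_integral M (excess (?a j) n)) x0"
      by (simp only: strong_integral_diff[OF E_L1[OF excess_L1] excess_L1] E_integral[OF excess_L1]
          strong_integral_const prob_space scaleR_one)
  qed
  finally show ?thesis .
qed

lemma truncated_increment_integral_small:
  assumes "0 < \<epsilon>"
  shows "\<exists>N. \<forall>n\<ge>N. \<forall>m\<ge>n. norm (strong_integral M (\<lambda>w. inf (E n (increment n m) w) x0)) \<le> \<epsilon>"
proof -
  have C: "0 \<le> C" using norm_integral_abs_z_le[of 0] norm_ge_zero order_trans by blast
  \<comment> \<open>\<open>\<epsilon>\<close> is shared in thirds: \<open>r\<close> handles the
    values beyond the grid, \<open>\<eta>\<close> the mesh, and \<open>\<delta>\<close> the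
    increments at the grid points. \<open>l\<close> is then taken large enough for mesh
    \<open>\<eta>\<close> to reach from \<open>- r\<close> to \<open>r\<close>.\<close>
  define r where "r = 6 * (C + 1) / \<epsilon>"
  define s where "s = norm x0 + 1"
  have s: "0 < s" by (simp add: s_def add_nonneg_pos)
  define \<eta> where "\<eta> = \<epsilon> / (3 * s)"
  have r: "0 < r" "2 / r * C \<le> \<epsilon> / 3"
    using C assms by (auto simp: r_def field_simps)
  have \<eta>: "0 < \<eta>" "\<eta> * norm x0 \<le> \<epsilon> / 3"
  proof -
    show "0 < \<eta>" using assms s by (simp add: \<eta>_def)
    have "\<epsilon> / 3 = \<eta> * s" using s by (simp add: \<eta>_def)
    then show "\<eta> * norm x0 \<le> \<epsilon> / 3" using \<open>0 < \<eta>\<close> by (simp add: s_def algebra_simps)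
  qed
  obtain l :: nat where "2 * r / \<eta> \<le> real l" using real_arch_simple by blast
  then have l: "2 * r \<le> real l * \<eta>" using \<eta>(1) by (simp add: field_simps)
  let ?a = "\<lambda>j. - r + real j * \<eta>"
  let ?d = "\<lambda>j n m. inf (strong_integral M (excess (?a j) m) - strong_integral M (excess (?a j) n)) x0"
  \<comment> \<open>The indices \<open>j \<le> l\<close> number \<open>Suc l\<close>, so the sum of
    the grid terms is at most \<open>\<epsilon> / 3\<close>.\<close>
  define \<delta> where "\<delta> = \<epsilon> / (3 * real (Suc l))"
  have "0 < \<delta>" using assms by (simp add: \<delta>_def)
  then have "\<forall>j. \<exists>N. \<forall>n\<ge>N. \<forall>m\<ge>n. norm (?d j n m) \<le> \<delta>"
    using truncated_excess_increment_small by blast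
  then obtain N where N: "\<And>j n m. N j \<le> n \<Longrightarrow> n \<le> m \<Longrightarrow> norm (?d j n m) \<le> \<delta>" by metis
  show ?thesis
  proof (intro exI[of _ "Max (N ` {..l})"] allI impI)
    fix n m assume n: "Max (N ` {..l}) \<le> n" and nm: "n \<le> m"
    have "N j \<le> n" if "j \<le> l" for j using n that by simp
    then have d: "norm (?d j n m) \<le> \<delta>" if "j \<le> l" for j using N[OF _ nm] that by blast
    have gL: "(\<lambda>w. inf (E n (increment n m) w) x0) \<in> L1 M"
      by (intro L1_inf E_L1 increment_L1 L1_const)
    have "AE w in M. 0 \<le> E n (increment n m) w"
      by (rule E_nonneg[OF increment_L1]) (simp add: increment_def)
    then have "0 \<le> strong_integral M (\<lambda>w. inf (E n (increment n m) w) x0)"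
      using x0_nonneg by (intro strong_integral_nonneg_AE[OF gL]) auto
    then have "norm (strong_integral M (\<lambda>w. inf (E n (increment n m) w) x0))
      \<le> norm ((\<Sum>j\<le>l. ?d j n m) + \<eta> *\<^sub>R x0 + (2 / r) *\<^sub>R strong_integral M (\<lambda>w. \<bar>z n w\<bar>))"
      using truncated_increment_integral_le[OF nm r(1) less_imp_le[OF \<eta>(1)] l]
      by (rule norm_mono_banach_lattice)
    also have "\<dots> \<le> (\<Sum>j\<le>l. norm (?d j n m)) + norm (\<eta> *\<^sub>R x0)
        + norm ((2 / r) *\<^sub>R strong_integral M (\<lambda>w. \<bar>z n w\<bar>))"
      by (intro norm_triangle_mono order_refl norm_sum)
    also have "\<dots> \<le> (\<Sum>j\<le>l. \<delta>) + \<epsilon> / 3 + \<epsilon> / 3"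
    proof (intro add_mono sum_mono d)
      show "norm (\<eta> *\<^sub>R x0) \<le> \<epsilon> / 3" using \<eta> by simp
      have "norm ((2 / r) *\<^sub>R strong_integral M (\<lambda>w. \<bar>z n w\<bar>)) \<le> 2 / r * C"
        using r(1) norm_integral_abs_z_le[of n] by (simp add: divide_right_mono)
      then show "norm ((2 / r) *\<^sub>R strong_integral M (\<lambda>w. \<bar>z n w\<bar>)) \<le> \<epsilon> / 3"
        using r(2) by linarith
    qed simp
    also have "\<dots> = \<epsilon>" by (simp add: \<delta>_def field_simps)
    finally show "norm (strong_integral M (\<lambda>w. inf (E n (increment n m) w) x0)) \<le> \<epsilon>" .
  qed
qed

lemma oscillation_nonneg: "0 \<le> oscillation N k w"
  unfolding oscillation_def
  by (rule order_trans[OF _ running_sup_upper[of N N]]) (simp_all add: x0_nonneg)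

lemma oscillation_le: "oscillation N k w \<le> x0"
  unfolding oscillation_def by (rule running_sup_least) simp

lemma oscillation_integral_small:
  assumes "0 < \<epsilon>"
  shows "\<exists>N. \<forall>n\<ge>N. \<forall>k. norm (strong_integral M (oscillation n k)) \<le> \<epsilon>"
proof -
  define s where "s = norm x0 + 1"
  have s: "0 < s" by (simp add: s_def add_nonneg_pos)
  \<comment> \<open>The cap \<open>2\<close> is demanded by \<open>oscillation_integral_le\<close>;
    the other bound gives \<open>t * norm x0 \<le> \<epsilon> / 2\<close>.\<close>
  define t where "t = min 2 (\<epsilon> / (2 * s))"
  have t: "0 < t" "t \<le> 2" "t \<le> \<epsilon> / (2 * s)" using assms s by (auto simp: t_def)
  have "t * s \<le> \<epsilon> / 2" using t(3) s by (simp add: field_simps)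
  then have tx: "t * norm x0 \<le> \<epsilon> / 2" using t(1) by (simp add: s_def algebra_simps)
  \<comment> \<open>With \<open>t\<close> already fixed, this tolerance absorbs the factor
    \<open>2 / t\<close> and leaves \<open>\<epsilon> / 2\<close>.\<close>
  have "0 < t * \<epsilon> / 4" using t assms by simp
  from truncated_increment_integral_small[OF this]
  obtain N where N: "\<And>n m. N \<le> n \<Longrightarrow> n \<le> m \<Longrightarrow>
    norm (strong_integral M (\<lambda>w. inf (E n (increment n m) w) x0)) \<le> t * \<epsilon> / 4" by blast
  show ?thesis
  proof (intro exI[of _ N] allI impI)
    fix n k assume n: "N \<le> n"
    let ?J = "strong_integral M (\<lambda>w. inf (E n (increment n (n + k)) w) x0)"
    have "0 \<le> strong_integral M (oscillation n k)"
      by (rule strong_integral_nonneg_AE[OF oscillation_L1]) (simp add: oscillation_nonneg)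
    then have "norm (strong_integral M (oscillation n k)) \<le> norm (t *\<^sub>R x0 + (2 / t) *\<^sub>R ?J)"
      using oscillation_integral_le[OF t(1,2)] by (rule norm_mono_banach_lattice)
    also have "\<dots> \<le> t * norm x0 + (2 / t) * norm ?J"
      using norm_triangle_ineq[of "t *\<^sub>R x0" "(2 / t) *\<^sub>R ?J"] t by simp
    also have "\<dots> \<le> \<epsilon> / 2 + (2 / t) * (t * \<epsilon> / 4)"
      using t tx N[OF n] by (intro add_mono mult_left_mono) auto
    also have "\<dots> = \<epsilon>" using t by simp
    finally show "norm (strong_integral M (oscillation n k)) \<le> \<epsilon>" .
  qed
qed

section \<open>Passage to the limit and almost sure vanishing\<close>

text \<open>This is the supremum of the truncated differences over all \<open>i \<ge> N\<close>,
  obtained as a norm limit so that measurability and integrals carry over. It exists because the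
  partial suprema increase and stay below \<open>x0\<close>.\<close>

definition tail_oscillation :: "nat \<Rightarrow> 'a \<Rightarrow> 'b" where
  "tail_oscillation N w = lim (\<lambda>k. oscillation N k w)"

lemma incseq_oscillation: "incseq (\<lambda>k. oscillation N k w)"
  unfolding oscillation_def by (rule incseq_running_sup)

lemma tail_oscillation_LIMSEQ: "(\<lambda>k. oscillation N k w) \<longlonglongrightarrow> tail_oscillation N w"
  unfolding tail_oscillation_def
  by (rule convergent_LIMSEQ_iff[THEN iffD1],
      rule order_bounded_incseq_convergent[OF order_continuous incseq_oscillation oscillation_le])

lemma norm_oscillation_le: "norm (oscillation N k w) \<le> norm x0"
  by (intro norm_mono_banach_lattice oscillation_nonneg oscillation_le)

lemmas tail_oscillation_integral =
  strong_integral_bounded_convergence[OF L1_strongly_measurable[OF oscillation_L1]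
    norm_oscillation_le tail_oscillation_LIMSEQ]

lemma tail_oscillation_nonneg: "0 \<le> tail_oscillation N w"
  by (rule LIMSEQ_nonneg[OF tail_oscillation_LIMSEQ]) (simp add: oscillation_nonneg)

lemma tail_oscillation_le: "tail_oscillation N w \<le> x0"
  by (rule LIMSEQ_le_lattice[OF tail_oscillation_LIMSEQ tendsto_const]) (simp add: oscillation_le)

text \<open>Both indices are compared with \<open>N\<close>, which explains the factor
  \<open>2\<close>.\<close>

lemma difference_le_tail_oscillation:
  assumes "N \<le> n" "N \<le> m"
  shows "inf \<bar>z n w - z m w\<bar> x0 \<le> 2 *\<^sub>R tail_oscillation N w"
proof -
  have le: "inf \<bar>z n w - z N w\<bar> x0 \<le> tail_oscillation N w" if "N \<le> n" for n
  proof -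
    have "inf \<bar>z n w - z N w\<bar> x0 \<le> oscillation N (n - N) w"
      unfolding oscillation_def using that by (intro running_sup_upper) auto
    also have "\<dots> \<le> tail_oscillation N w"
      by (rule incseq_le_LIMSEQ[OF incseq_oscillation tail_oscillation_LIMSEQ])
    finally show ?thesis .
  qed
  have "inf \<bar>z n w - z m w\<bar> x0 \<le> inf \<bar>z n w - z N w\<bar> x0 + inf \<bar>z m w - z N w\<bar> x0"
    by (rule inf_abs_diff_triangle[OF x0_nonneg])
  also have "\<dots> \<le> tail_oscillation N w + tail_oscillation N w"
    by (intro add_mono le assms)
  finally show ?thesis by (simp add: scaleR_2)
qed

lemma AE_uo_Cauchy: "AE w in M. uo_Cauchy (\<lambda>n. z n w)"
proof -
  \<comment> \<open>The tail oscillations refer to the moving index \<open>N\<close> and need not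
    decrease in \<open>N\<close>. Their running infimum does, and it still bounds the differences
    beyond \<open>N\<close>, since all earlier bounds apply there too.\<close>
  define V where "V N w = rec_nat (2 *\<^sub>R tail_oscillation 0 w) (\<lambda>j v. inf v (2 *\<^sub>R tail_oscillation (Suc j) w)) N" for N w
  have V: "V 0 w = 2 *\<^sub>R tail_oscillation 0 w" "V (Suc N) w = inf (V N w) (2 *\<^sub>R tail_oscillation (Suc N) w)" for N w
    by (simp_all add: V_def)
  have T_L1: "(\<lambda>w. 2 *\<^sub>R tail_oscillation N w) \<in> L1 M" for N
    by (intro L1_scaleR tail_oscillation_integral(1))
  have V_L1: "V N \<in> L1 M" for N
  proof (induction N)
    case 0
    show ?case using T_L1[of 0] by (simp add: V(1)[abs_def])
  next
    case (Suc N)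
    show ?case using L1_inf[OF Suc T_L1[of "Suc N"]] by (simp add: V(2)[abs_def])
  qed
  have V_nonneg: "0 \<le> V N w" for N w
    by (induction N) (simp_all add: V scaleR_nonneg_nonneg tail_oscillation_nonneg)
  have V_le: "V N w \<le> 2 *\<^sub>R tail_oscillation N w" for N w
    by (cases N) (simp_all add: V)
  have V_dec: "decseq (\<lambda>N. V N w)" for w by (intro decseq_SucI) (simp add: V)
  have V_norm: "norm (V N w) \<le> norm (2 *\<^sub>R x0)" for N w
    by (intro norm_mono_banach_lattice V_nonneg order_trans[OF V_le] scaleR_left_mono tail_oscillation_le) simp
  have V_diff: "inf \<bar>z n w - z m w\<bar> x0 \<le> V N w" if "N \<le> n" "N \<le> m" for N n m w
    using that by (induction N) (simp_all add: V difference_le_tail_oscillation)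
  define U where "U w = lim (\<lambda>N. V N w)" for w
  have V_lim: "(\<lambda>N. V N w) \<longlonglongrightarrow> U w" for w
    unfolding U_def
    by (rule convergent_LIMSEQ_iff[THEN iffD1],
        rule order_bounded_decseq_convergent[OF order_continuous V_dec V_nonneg])
  have U_L1: "U \<in> L1 M"
    by (rule strong_integral_bounded_convergence(1)[OF L1_strongly_measurable[OF V_L1] V_norm V_lim])
  have U_nonneg: "0 \<le> U w" for w
    by (rule LIMSEQ_nonneg[OF V_lim]) (simp add: V_nonneg)
  have U_le: "U w \<le> 2 *\<^sub>R tail_oscillation N w" for N w
    using decseq_ge_LIMSEQ[OF V_dec V_lim] V_le order_trans by blast
  have U_int_nonneg: "0 \<le> strong_integral M U"
    by (rule strong_integral_nonneg_AE[OF U_L1]) (simp add: U_nonneg)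
  have "norm (strong_integral M U) \<le> \<epsilon>" if \<epsilon>: "0 < \<epsilon>" for \<epsilon>
  proof -
    obtain N where "\<forall>n\<ge>N. \<forall>k. norm (strong_integral M (oscillation n k)) \<le> \<epsilon> / 2"
      using oscillation_integral_small[OF half_gt_zero[OF \<epsilon>]] by blast
    then have N: "\<And>k. norm (strong_integral M (oscillation N k)) \<le> \<epsilon> / 2" by blast
    have "norm (strong_integral M (tail_oscillation N)) \<le> \<epsilon> / 2"
      by (rule LIMSEQ_le_const2[OF tendsto_norm[OF tail_oscillation_integral(2)]]) (use N in auto)
    moreover have "strong_integral M U \<le> 2 *\<^sub>R strong_integral M (tail_oscillation N)"
      using strong_integral_mono_AE[OF U_L1 T_L1, of N]
      by (simp add: U_le strong_integral_scaleR tail_oscillation_integral(1))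
    ultimately show ?thesis
      using norm_mono_banach_lattice[OF U_int_nonneg] by fastforce
  qed
  then have U_int: "strong_integral M U = 0"
    by (metis field_le_epsilon add_0 norm_le_zero_iff)
  \<comment> \<open>A nonnegative function of integral \<open>0\<close> vanishes almost everywhere:
    its integral over any set is at most \<open>0\<close>, so the positivity criterion applies to
    its negative, with \<open>M\<close> itself as the sub-field.\<close>
  have "AE w in M. 0 \<le> - 1 *\<^sub>R U w"
  proof (rule AE_nonneg_if_set_integrals_nonneg[of M])
    show "subalgebra M M" by (simp add: subalgebra_def)
  next
    fix A assume A: "A \<in> sets M"
    have "strong_integral M (\<lambda>w. indicator A w *\<^sub>R U w) \<le> strong_integral M U"
      by (intro strong_integral_mono_AE L1_indicator U_L1 A) (auto simp: indicator_def U_nonneg)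
    moreover have "strong_integral M (\<lambda>w. indicator A w *\<^sub>R (- 1 *\<^sub>R U w)) =
        - 1 *\<^sub>R strong_integral M (\<lambda>w. indicator A w *\<^sub>R U w)"
      using strong_integral_scaleR[OF L1_indicator[OF U_L1 A], of "-1"] by simp
    ultimately show "0 \<le> strong_integral M (\<lambda>w. indicator A w *\<^sub>R (- 1 *\<^sub>R U w))"
      by (simp add: U_int)
  qed (intro L1_scaleR L1_strongly_measurable U_L1)+
  then show ?thesis
  proof eventually_elim
    case (elim w)
    then have "U w = 0" using U_nonneg[of w] by (simp add: antisym)
    then have lim: "(\<lambda>N. V N w) \<longlonglongrightarrow> 0" using V_lim[of w] by simp
    show ?case
    proof (rule uo_CauchyI_weak_unit[OF order_continuous weak_unit])
      fix e :: real assume "0 < e"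
      then obtain N where "norm (V N w) < e" using LIMSEQ_D[OF lim] by auto
      then show "\<exists>N u. norm u < e \<and> (\<forall>n\<ge>N. \<forall>m\<ge>N. inf \<bar>z n w - z m w\<bar> x0 \<le> u)"
        using V_diff by blast
    qed
  qed
qed

end

theorem corollary5p7:
  fixes M :: "'w measure"
    and E :: "nat \<Rightarrow> ('w \<Rightarrow> 'f::banach_lattice) \<Rightarrow> ('w \<Rightarrow> 'f)"
    and z :: "nat \<Rightarrow> 'w \<Rightarrow> 'f"
  assumes "order_continuous TYPE('f)"
    and "\<exists>x0 :: 'f. weak_unit x0"
    and "prob_space M"
    and "classical_filtration M E"
    and "submartingale M E z"
    and "L1_norm_bounded M z"
  shows "AE w in M. uo_Cauchy (\<lambda>n. z n w)"
proof -
  obtain x0 :: 'f where x0: "weak_unit x0" using assms(2) by blast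
  obtain C where C: "\<And>n. (LINT w|M. norm (z n w)) \<le> C"
    using assms(6) by (auto simp: L1_norm_bounded_def)
  obtain F where F: "filtration (space M) F" "\<And>n. subalgebra M (F n)"
    "\<And>n f. f \<in> L1 M \<Longrightarrow> is_cond_exp M (F n) f (E n f)"
    using assms(4) by (auto simp: classical_filtration_def)
  interpret filtered_cond_exp M F E
    by (intro filtered_cond_exp.intro filtered_cond_exp_axioms.intro assms(3) F)
  have z: "z n \<in> L1 M" "\<exists>f\<in>L1 M. AE w in M. z n w = E n f w"
    "n \<le> m \<Longrightarrow> AE w in M. z n w \<le> E n (z m) w" for n m
    using assms(5) by (auto simp: submartingale_def)
  have "adapted n (z n)" for n
    using z(2)[of n] adapted_cong_AE[OF z(1) _ adapted_E] by blast
  then interpret lattice_submartingale M F E z x0 C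
    using assms(1) x0 C z(3) by unfold_locales
  show ?thesis by (rule AE_uo_Cauchy)
qed

end
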